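(* Fix $0<a<b$, and let $f_n$ be the indicator of the property that the critical Erdős–Rényi random graph $\mathcal{G}(n,1/n)$ contains a cycle of some length $\ell\in(a n^{1/3}, b n^{1/3})$. Then $(f_n)$ is nondegenerate and noise sensitive, and furthermore it is 1-strongly noise sensitive (all with respect to $p_n=1/n$). Moreover, for a noise parameter $\varepsilon=\varepsilon(n)\in(0,1)$, the sequence $(f_n)$ is quantitatively noise sensitive w.r.t. $\varepsilon(n)$, respectively quantitatively 1-strongly noise sensitive w.r.t. $\varepsilon(n)$, if and only if $\varepsilon(n)\gg n^{-1/3}$.
   Context: Setting: $f_n:\Omega_n=\{0,1\}^{\Lambda_n}\to\{0,1\}$ are Boolean functions, $\Lambda_n$ finite, and $\Omega_n$ carries the product measure $\mathbb{P}$ under which the coordinates are i.i.d. Bernoulli$(p_n)$. For the random graph $\mathcal{G}(n,p)$, $\Lambda_n$ is the set of $\binom n2$ potential edges of a graph on $n$ labeled vertices and $p_n=p$; a monotone increasing graph property is identified with its indicator. The sequence is nondegenerate if $\mathbb{P}(f_n=1)$ is bounded away from $0$ and $1$ as $n\to\infty$. For $\omega\in\Omega_n$ and $\varepsilon\in(0,1)$, $\omega^\varepsilon$ is obtained from $\omega$ by independently resampling each coordinate (from Bernoulli$(p_n)$) with probability $\varepsilon$. Noise sensitive: for every fixed $\varepsilon\in(0,1)$, $\lim_{n\to\infty}\mathbb{P}(f_n(\omega^\varepsilon)=1\mid f_n(\omega)=1)-\mathbb{P}(f_n=1)=0$. Quantitatively noise sensitive w.r.t. $\varepsilon(n)$: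 the same limit holds with $\varepsilon=\varepsilon(n)$. A 1-witness for a monotone increasing $f$ is a minimal subset $W\subset\Lambda$ such that $\omega_W\equiv1$ implies $f(\omega)=1$; $\mathcal{W}_1(f)$ is the set of 1-witnesses. 1-strongly noise sensitive: for every fixed $\varepsilon\in(0,1)$, $\lim_{n\to\infty}\max_{W\in\mathcal{W}_1(f_n)}\mathbb{P}(f_n(\omega^\varepsilon)=1\mid\omega_W\equiv1)-\mathbb{P}(f_n=1)=0$. Quantitatively 1-strongly noise sensitive w.r.t. $\varepsilon(n)$: the same limit holds with $\varepsilon=\varepsilon(n)$. Notation: $g\gg h$ means $h/g\to0$. *)

theory Defs
  imports "HOL-Probability.Probability"
begin

section \<open>Boolean functions under product Bernoulli measure\<close>

text \<open>
  A point of \<open>\<Omega> = {0,1}^\<Lambda>\<close> is represented by a predicate \<open>\<omega> :: 'e \<Rightarrow> bool\<close> that is \<open>False\<close> outside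
  the finite set \<open>\<Lambda>\<close>; these are exactly the elements of \<open>PiE_dflt \<Lambda> False (\<lambda>_. UNIV)\<close>, the space
  over which \<^const>\<open>Pi_pmf\<close> with default value \<open>False\<close> lives.
\<close>

definition configs :: "'e set \<Rightarrow> ('e \<Rightarrow> bool) set" where
  "configs \<Lambda> = PiE_dflt \<Lambda> False (\<lambda>_. UNIV)"

definition bernoulli_product :: "'e set \<Rightarrow> real \<Rightarrow> ('e \<Rightarrow> bool) pmf" where
  "bernoulli_product \<Lambda> p = Pi_pmf \<Lambda> False (\<lambda>_. bernoulli_pmf p)"

text \<open>
  The joint law of \<open>(\<omega>, \<omega>\<^sup>\<epsilon>)\<close>: \<open>r\<close> marks the coordinates to be resampled and \<open>\<eta>\<close> supplies the
  fresh values; \<open>\<omega>\<close>, \<open>r\<close>, \<open>\<eta>\<close> are independent.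
\<close>

definition noise_pair ::
    "'e set \<Rightarrow> real \<Rightarrow> real \<Rightarrow> (('e \<Rightarrow> bool) \<times> ('e \<Rightarrow> bool)) pmf" where
  "noise_pair \<Lambda> p \<epsilon> = do {
     \<omega> \<leftarrow> bernoulli_product \<Lambda> p;
     r \<leftarrow> bernoulli_product \<Lambda> \<epsilon>;
     \<eta> \<leftarrow> bernoulli_product \<Lambda> p;
     return_pmf (\<omega>, \<lambda>e. if r e then \<eta> e else \<omega> e)
   }"

definition prob_true :: "'e set \<Rightarrow> real \<Rightarrow> (('e \<Rightarrow> bool) \<Rightarrow> bool) \<Rightarrow> real" where
  "prob_true \<Lambda> p f = \<P>(\<omega> in measure_pmf (bernoulli_product \<Lambda> p). f \<omega>)"

text \<open>``As \<open>n \<rightarrow> \<infinity>\<close>'' means that finitely many \<open>n\<close> are disregarded.\<close>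

definition nondegenerate ::
    "(nat \<Rightarrow> 'e set) \<Rightarrow> (nat \<Rightarrow> real) \<Rightarrow> (nat \<Rightarrow> ('e \<Rightarrow> bool) \<Rightarrow> bool) \<Rightarrow> bool" where
  "nondegenerate \<Lambda> p f \<longleftrightarrow>
     (\<exists>\<delta>>0. \<forall>\<^sub>F n in sequentially.
        \<delta> \<le> prob_true (\<Lambda> n) (p n) (f n) \<and> prob_true (\<Lambda> n) (p n) (f n) \<le> 1 - \<delta>)"

definition quant_noise_sensitive ::
    "(nat \<Rightarrow> 'e set) \<Rightarrow> (nat \<Rightarrow> real) \<Rightarrow> (nat \<Rightarrow> ('e \<Rightarrow> bool) \<Rightarrow> bool) \<Rightarrow> (nat \<Rightarrow> real) \<Rightarrow> bool" where
  "quant_noise_sensitive \<Lambda> p f \<epsilon> \<longleftrightarrow>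
     (\<lambda>n. \<P>((\<omega>, \<omega>') in measure_pmf (noise_pair (\<Lambda> n) (p n) (\<epsilon> n)). f n \<omega>' \<bar> f n \<omega>)
           - prob_true (\<Lambda> n) (p n) (f n)) \<longlonglongrightarrow> 0"

definition noise_sensitive ::
    "(nat \<Rightarrow> 'e set) \<Rightarrow> (nat \<Rightarrow> real) \<Rightarrow> (nat \<Rightarrow> ('e \<Rightarrow> bool) \<Rightarrow> bool) \<Rightarrow> bool" where
  "noise_sensitive \<Lambda> p f \<longleftrightarrow>
     (\<forall>\<epsilon>\<in>{0<..<1}. quant_noise_sensitive \<Lambda> p f (\<lambda>_. \<epsilon>))"

definition forces_true :: "'e set \<Rightarrow> (('e \<Rightarrow> bool) \<Rightarrow> bool) \<Rightarrow> 'e set \<Rightarrow> bool" where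
  "forces_true \<Lambda> f W \<longleftrightarrow> (\<forall>\<omega>\<in>configs \<Lambda>. (\<forall>e\<in>W. \<omega> e) \<longrightarrow> f \<omega>)"

definition one_witnesses :: "'e set \<Rightarrow> (('e \<Rightarrow> bool) \<Rightarrow> bool) \<Rightarrow> 'e set set" where
  "one_witnesses \<Lambda> f =
     {W. W \<subseteq> \<Lambda> \<and> forces_true \<Lambda> f W \<and> (\<forall>V. V \<subset> W \<longrightarrow> \<not> forces_true \<Lambda> f V)}"

text \<open>
  \<open>f n\<close> has a 1-witness unless it vanishes identically, so for a nondegenerate sequence the maximum
  is over a nonempty (finite) set for all large \<open>n\<close>.
\<close>

definition quant_one_strongly_noise_sensitive ::
    "(nat \<Rightarrow> 'e set) \<Rightarrow> (nat \<Rightarrow> real) \<Rightarrow> (nat \<Rightarrow> ('e \<Rightarrow> bool) \<Rightarrow> bool) \<Rightarrow> (nat \<Rightarrow> real) \<Rightarrow> bool" where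
  "quant_one_strongly_noise_sensitive \<Lambda> p f \<epsilon> \<longleftrightarrow>
     (\<lambda>n. (MAX W\<in>one_witnesses (\<Lambda> n) (f n).
             \<P>((\<omega>, \<omega>') in measure_pmf (noise_pair (\<Lambda> n) (p n) (\<epsilon> n)). f n \<omega>' \<bar> \<forall>e\<in>W. \<omega> e))
           - prob_true (\<Lambda> n) (p n) (f n)) \<longlonglongrightarrow> 0"

definition one_strongly_noise_sensitive ::
    "(nat \<Rightarrow> 'e set) \<Rightarrow> (nat \<Rightarrow> real) \<Rightarrow> (nat \<Rightarrow> ('e \<Rightarrow> bool) \<Rightarrow> bool) \<Rightarrow> bool" where
  "one_strongly_noise_sensitive \<Lambda> p f \<longleftrightarrow>
     (\<forall>\<epsilon>\<in>{0<..<1}. quant_one_strongly_noise_sensitive \<Lambda> p f (\<lambda>_. \<epsilon>))"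

definition much_greater :: "(nat \<Rightarrow> real) \<Rightarrow> (nat \<Rightarrow> real) \<Rightarrow> bool" where
  "much_greater g h \<longleftrightarrow> (\<lambda>n. h n / g n) \<longlonglongrightarrow> 0"

section \<open>Cycles in the random graph\<close>

text \<open>
  The vertices are \<open>{..<n}\<close> and an edge is a two-element set of vertices, so a configuration on
  \<open>potential_edges n\<close> is a simple graph.
\<close>

definition potential_edges :: "nat \<Rightarrow> nat set set" where
  "potential_edges n = {e. e \<subseteq> {..<n} \<and> card e = 2}"

text \<open>A cycle is given by the cyclic list of its vertices; its length is the length of the list.\<close>

definition is_cycle :: "nat \<Rightarrow> (nat set \<Rightarrow> bool) \<Rightarrow> nat list \<Rightarrow> bool" where
  "is_cycle n \<omega> vs \<longleftrightarrow>
     3 \<le> length vs \<and> distinct vs \<and> set vs \<subseteq> {..<n} \<and>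
     (\<forall>i<length vs. \<omega> {vs ! i, vs ! (Suc i mod length vs)})"

definition has_medium_cycle :: "real \<Rightarrow> real \<Rightarrow> nat \<Rightarrow> (nat set \<Rightarrow> bool) \<Rightarrow> bool" where
  "has_medium_cycle a b n \<omega> \<longleftrightarrow>
     (\<exists>vs. is_cycle n \<omega> vs \<and>
        real (length vs) \<in> {a * real n powr (1/3) <..< b * real n powr (1/3)})"

end

theory Submission
  imports Defs "HOL-Real_Asymp.Real_Asymp"
begin

text \<open>
  Everything reduces to first and second moments of cycles. Let \<open>N = n\<^sup>1\<^sup>/\<^sup>3\<close>. Conditioning on a medium
  cycle \<open>C\<close> turns the law of \<open>\<omega>\<^sup>\<epsilon>\<close> into a product measure in which the edges of \<open>C\<close> are kept with
  probability about \<open>1 - \<epsilon>\<close>. Another medium cycle meeting \<open>C\<close> in \<open>k\<close> runs has, for each run, about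
  \<open>N\<close> places to start, \<open>1 / \<epsilon>\<close> lengths of the run and \<open>N\<close> lengths of the excursion back to \<open>C\<close>, which closes up with
  probability \<open>1 / n\<close>; the expected number of such cycles is thus a power series in \<open>1 / (N \<epsilon>)\<close>, while
  \<open>C\<close> itself survives with probability about \<open>exp (- \<epsilon> N)\<close>. This gives strong noise sensitivity for
  \<open>\<epsilon> N \<rightarrow> \<infinity>\<close>, and noise sensitivity follows by Harris' inequality.

  If \<open>\<epsilon> N\<close> stays bounded along a subsequence, \<open>C\<close> survives with probability bounded below. Testing the
  positive semidefinite noise operator against the number of medium cycles, whose second moment is
  bounded by the same count of overlapping cycles, shows that the autocorrelation of \<open>f\<close> does not
  vanish. That second moment also bounds \<open>\<P>(f = 1)\<close> from below; for the upper bound the range of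
  lengths is cut into short pieces, each avoided with probability at least \<open>1 / 2\<close>, and the pieces are
  combined by Harris' inequality.
\<close>

section \<open>Expectations under product Bernoulli measures\<close>

text \<open>Both equivalences are proved as one circle. With
  \<open>u = 1 / (N * \<epsilon>)\<close>, \<open>u\<close> tending to 0 makes the witness gap
  vanish; the witness gap dominates the noise gap, which is nonnegative; and a vanishing noise gap
  forces \<open>u\<close> to tend to 0. So upper bounds are needed only after conditioning on a
  single cycle, lower bounds only for the plain correlation, and constant \<open>\<epsilon>\<close>
  is a special case. The obstacle is criticality. A free step of a path has about \<open>n\<close>
  choices of probability \<open>1 / n\<close>, so the series over excursion lengths has ratio 1;
  when \<open>C\<close> is present and there is no noise, the series over run lengths has ratio 1
  too. As medium lengths are at most \<open>b * N\<close>, a discount of order \<open>1 / N\<close>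
  per edge is affordable and pushes both ratios below 1. Overlapping cycles are not enumerated by
  their number of runs: a linear recursion in the length, whose states record how the current vertex
  was reached, is summed over all lengths, and the resulting system is solvable as soon as one more
  run costs a factor of at most 1/2.\<close>

definition bexp :: "'e set \<Rightarrow> ('e \<Rightarrow> real) \<Rightarrow> (('e \<Rightarrow> bool) \<Rightarrow> real) \<Rightarrow> real" where
  "bexp A \<pi> g = measure_pmf.expectation (Pi_pmf A False (\<lambda>e. bernoulli_pmf (\<pi> e))) g"

lemma set_bernoulli_product_subset_configs:
  "finite A \<Longrightarrow> set_pmf (Pi_pmf A False P) \<subseteq> configs A"
  using set_Pi_pmf_subset'[of A False P] by (auto simp: configs_def PiE_dflt_def)

lemma finite_configs: "finite A \<Longrightarrow> finite (configs A)"
  by (auto simp: configs_def)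

lemma finite_set_bernoulli_product: "finite A \<Longrightarrow> finite (set_pmf (Pi_pmf A False (P :: 'e \<Rightarrow> bool pmf)))"
  by (rule finite_subset[OF set_bernoulli_product_subset_configs finite_configs])

lemma bexp_cong:
  assumes "finite A" "\<And>\<omega>. \<omega> \<in> configs A \<Longrightarrow> g \<omega> = h \<omega>" "\<And>e. e \<in> A \<Longrightarrow> \<pi> e = \<rho> e"
  shows "bexp A \<pi> g = bexp A \<rho> h"
proof -
  have "Pi_pmf A False (\<lambda>e. bernoulli_pmf (\<pi> e)) = Pi_pmf A False (\<lambda>e. bernoulli_pmf (\<rho> e))"
    using assms by (intro Pi_pmf_cong) auto
  moreover have "measure_pmf.expectation (Pi_pmf A False (\<lambda>e. bernoulli_pmf (\<rho> e))) g
      = measure_pmf.expectation (Pi_pmf A False (\<lambda>e. bernoulli_pmf (\<rho> e))) h"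
    using set_bernoulli_product_subset_configs[OF assms(1), of "\<lambda>e. bernoulli_pmf (\<rho> e)"] assms(2)
    by (intro integral_cong_AE) (auto simp: AE_measure_pmf_iff)
  ultimately show ?thesis by (simp add: bexp_def)
qed

lemma bexp_mono:
  assumes "finite A" "\<And>\<omega>. \<omega> \<in> configs A \<Longrightarrow> g \<omega> \<le> h \<omega>"
  shows "bexp A \<pi> g \<le> bexp A \<pi> h"
  unfolding bexp_def
  using set_bernoulli_product_subset_configs[OF assms(1), of "\<lambda>e. bernoulli_pmf (\<pi> e)"] assms
  by (intro integral_mono_AE integrable_measure_pmf_finite finite_set_bernoulli_product)
     (auto simp: AE_measure_pmf_iff)

lemma bexp_const [simp]: "bexp A \<pi> (\<lambda>_. c) = c"
  by (simp add: bexp_def)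

lemma bexp_add: "finite A \<Longrightarrow> bexp A \<pi> (\<lambda>\<omega>. g \<omega> + h \<omega>) = bexp A \<pi> g + bexp A \<pi> h"
  by (simp add: bexp_def integrable_measure_pmf_finite finite_set_bernoulli_product)

lemma bexp_diff: "finite A \<Longrightarrow> bexp A \<pi> (\<lambda>\<omega>. g \<omega> - h \<omega>) = bexp A \<pi> g - bexp A \<pi> h"
  by (simp add: bexp_def integrable_measure_pmf_finite finite_set_bernoulli_product)

lemma bexp_cmult: "bexp A \<pi> (\<lambda>\<omega>. c * g \<omega>) = c * bexp A \<pi> g"
  by (simp add: bexp_def)

lemma bexp_sum: "finite A \<Longrightarrow> bexp A \<pi> (\<lambda>\<omega>. \<Sum>i\<in>I. g i \<omega>) = (\<Sum>i\<in>I. bexp A \<pi> (g i))"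
  by (simp add: bexp_def integrable_measure_pmf_finite finite_set_bernoulli_product)

lemma bexp_nonneg: "finite A \<Longrightarrow> (\<And>\<omega>. \<omega> \<in> configs A \<Longrightarrow> 0 \<le> g \<omega>) \<Longrightarrow> 0 \<le> bexp A \<pi> g"
  using bexp_mono[of A "\<lambda>_. 0" g \<pi>] by simp

lemma bexp_empty: "bexp {} \<pi> g = g (\<lambda>_. False)"
  by (simp add: bexp_def)

lemma expectation_bind_finite:
  fixes h :: "'b \<Rightarrow> real"
  assumes "finite (set_pmf p)" "\<And>x. x \<in> set_pmf p \<Longrightarrow> finite (set_pmf (f x))"
  shows "measure_pmf.expectation (p \<bind> f) h
    = measure_pmf.expectation p (\<lambda>x. measure_pmf.expectation (f x) h)"
proof -
  have "measure_pmf.expectation p g = (\<Sum>x\<in>set_pmf p. pmf p x * g x)" for g :: "'a \<Rightarrow> real"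
    using assms(1) by (subst integral_measure_pmf[of "set_pmf p"]) auto
  then show ?thesis
    using assms by (subst pmf_expectation_bind[of "set_pmf p"]) auto
qed

text \<open>The induction step for statements about arbitrary finite \<open>A\<close>: one
  coordinate is revealed and the function is specialised to each of its two values.\<close>

lemma bexp_insert:
  assumes "finite A" "e \<notin> A" "0 \<le> \<pi> e" "\<pi> e \<le> 1"
  shows "bexp (insert e A) \<pi> g
    = \<pi> e * bexp A \<pi> (\<lambda>\<omega>. g (\<omega> (e := True))) + (1 - \<pi> e) * bexp A \<pi> (\<lambda>\<omega>. g (\<omega> (e := False)))"
proof -
  let ?P = "Pi_pmf A False (\<lambda>e. bernoulli_pmf (\<pi> e))"
  have "measure_pmf.expectation (?P \<bind> (\<lambda>\<omega>. return_pmf (\<omega> (e := b)))) g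
      = measure_pmf.expectation ?P (\<lambda>\<omega>. g (\<omega> (e := b)))" for b
    using assms(1) by (subst expectation_bind_finite) (auto simp: finite_set_bernoulli_product)
  then show ?thesis
    unfolding bexp_def Pi_pmf_insert'[OF assms(1,2)]
    using assms by (subst expectation_bind_finite) (auto simp: finite_set_bernoulli_product)
qed

lemma bexp_swap:
  assumes "finite A" "finite B"
  shows "bexp A \<pi> (\<lambda>\<omega>. bexp B \<rho> (\<lambda>\<eta>. g \<omega> \<eta>)) = bexp B \<rho> (\<lambda>\<eta>. bexp A \<pi> (\<lambda>\<omega>. g \<omega> \<eta>))"
proof -
  let ?P = "Pi_pmf A False (\<lambda>e. bernoulli_pmf (\<pi> e))" and ?Q = "Pi_pmf B False (\<lambda>e. bernoulli_pmf (\<rho> e))"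
  have P: "measure_pmf.expectation ?P h = (\<Sum>\<omega>\<in>configs A. pmf ?P \<omega> * h \<omega>)" for h :: "_ \<Rightarrow> real"
    using set_bernoulli_product_subset_configs[OF assms(1)] 
    by (subst integral_measure_pmf[of "configs A"]) (auto simp: finite_configs assms)
  have Q: "measure_pmf.expectation ?Q h = (\<Sum>\<omega>\<in>configs B. pmf ?Q \<omega> * h \<omega>)" for h :: "_ \<Rightarrow> real"
    using set_bernoulli_product_subset_configs[OF assms(2)] 
    by (subst integral_measure_pmf[of "configs B"]) (auto simp: finite_configs assms)
  show ?thesis
    unfolding bexp_def P Q sum_distrib_left
    by (subst sum.swap) (simp add: mult_ac)
qed

lemma mono_fun_upd:
  fixes g :: "('e \<Rightarrow> bool) \<Rightarrow> real"
  shows "mono g \<Longrightarrow> mono (\<lambda>\<omega>. g (\<omega> (e := b)))"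
  by (auto simp: mono_def le_fun_def)

lemma mono_upd_le:
  fixes g :: "('e \<Rightarrow> bool) \<Rightarrow> real"
  shows "mono g \<Longrightarrow> g (\<omega> (e := False)) \<le> g (\<omega> (e := True))"
  by (erule monoD) (auto simp: le_fun_def)

text \<open>Induction on the coordinates. Revealing \<open>e\<close> gives two averages of
  \<open>g\<close> and two of \<open>h\<close>, ordered the same way; the covariance of these
  two-point variables is \<open>\<pi> e * (1 - \<pi> e)\<close> times the product of the increments,
  hence nonnegative. The induction hypothesis covers what happens within each value of
  \<open>e\<close>.\<close>

lemma bexp_Harris:
  fixes g h :: "('e \<Rightarrow> bool) \<Rightarrow> real"
  assumes "finite A" "\<And>e. e \<in> A \<Longrightarrow> 0 \<le> \<pi> e \<and> \<pi> e \<le> 1" "mono g" "mono h"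
  shows "bexp A \<pi> g * bexp A \<pi> h \<le> bexp A \<pi> (\<lambda>\<omega>. g \<omega> * h \<omega>)"
  using assms
proof (induction A arbitrary: g h rule: finite_induct)
  case empty
  then show ?case by (simp add: bexp_empty)
next
  case (insert e A)
  define G H where "G = (\<lambda>b. bexp A \<pi> (\<lambda>\<omega>. g (\<omega> (e := b))))" and "H = (\<lambda>b. bexp A \<pi> (\<lambda>\<omega>. h (\<omega> (e := b))))"
  have IH: "G b * H b \<le> bexp A \<pi> (\<lambda>\<omega>. g (\<omega> (e := b)) * h (\<omega> (e := b)))" for b
    unfolding G_def H_def using insert.prems
    by (intro insert.IH mono_fun_upd) auto
  have mono: "G False \<le> G True" "H False \<le> H True"
    unfolding G_def H_def using insert.prems(2,3) insert.hyps
    by (auto intro!: bexp_mono mono_upd_le)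
  have e: "0 \<le> \<pi> e" "\<pi> e \<le> 1" using insert.prems by auto
  have "0 \<le> \<pi> e * (1 - \<pi> e) * ((G True - G False) * (H True - H False))"
    using e mono by (intro mult_nonneg_nonneg) auto
  then have "(\<pi> e * G True + (1 - \<pi> e) * G False) * (\<pi> e * H True + (1 - \<pi> e) * H False)
      \<le> \<pi> e * (G True * H True) + (1 - \<pi> e) * (G False * H False)"
    by (simp add: algebra_simps)
  also have "\<dots> \<le> \<pi> e * bexp A \<pi> (\<lambda>\<omega>. g (\<omega> (e := True)) * h (\<omega> (e := True)))
      + (1 - \<pi> e) * bexp A \<pi> (\<lambda>\<omega>. g (\<omega> (e := False)) * h (\<omega> (e := False)))"
    using e IH by (intro add_mono mult_left_mono) auto
  finally show ?case
    using e insert.hyps by (simp add: bexp_insert G_def H_def)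
qed

section \<open>Conditioning on open coordinates\<close>

definition all_on :: "'e set \<Rightarrow> ('e \<Rightarrow> bool) \<Rightarrow> real" where
  "all_on W \<omega> = of_bool (\<forall>e\<in>W. \<omega> e)"

text \<open>Conditioning without division: coordinates in \<open>W\<close> get parameter 1, the
  others keep theirs by independence. Parameters that vary with the coordinate keep the result
  inside the class of product measures.\<close>

lemma bexp_all_on_mult:
  assumes "finite A" "W \<subseteq> A" "\<And>e. e \<in> A \<Longrightarrow> 0 \<le> \<pi> e \<and> \<pi> e \<le> 1"
  shows "bexp A \<pi> (\<lambda>\<omega>. all_on W \<omega> * g \<omega>) = (\<Prod>e\<in>W. \<pi> e) * bexp A (\<lambda>e. if e \<in> W then 1 else \<pi> e) g"
  using assms
proof (induction A arbitrary: g W rule: finite_induct)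
  case empty
  then show ?case by (simp add: bexp_empty all_on_def)
next
  case (insert e A)
  have e: "0 \<le> \<pi> e" "\<pi> e \<le> 1" using insert.prems by auto
  have fin: "finite W" using insert.hyps insert.prems finite_subset by blast
  show ?case
  proof (cases "e \<in> W")
    case True
    have all: "all_on W (\<omega> (e := True)) = all_on (W - {e}) \<omega>" "all_on W (\<omega> (e := False)) = 0" for \<omega>
      using True by (auto simp: all_on_def)
    have "bexp (insert e A) \<pi> (\<lambda>\<omega>. all_on W \<omega> * g \<omega>)
        = \<pi> e * bexp A \<pi> (\<lambda>\<omega>. all_on (W - {e}) \<omega> * g (\<omega> (e := True)))"
      using e by (simp add: bexp_insert insert.hyps all)
    also have "\<dots> = \<pi> e * ((\<Prod>e\<in>W - {e}. \<pi> e) * bexp A (\<lambda>x. if x \<in> W - {e} then 1 else \<pi> x) (\<lambda>\<omega>. g (\<omega> (e := True))))"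
      using insert.prems by (subst insert.IH) auto
    also have "bexp A (\<lambda>x. if x \<in> W - {e} then 1 else \<pi> x) (\<lambda>\<omega>. g (\<omega> (e := True)))
        = bexp A (\<lambda>x. if x \<in> W then 1 else \<pi> x) (\<lambda>\<omega>. g (\<omega> (e := True)))"
      using insert.hyps by (intro bexp_cong) auto
    finally show ?thesis
      using True by (simp add: bexp_insert insert.hyps prod.remove[OF fin True])
  next
    case False
    have all: "all_on W (\<omega> (e := b)) = all_on W \<omega>" for \<omega> b
      using False by (auto simp: all_on_def)
    have W: "W \<subseteq> A" using False insert.prems by auto
    show ?thesis
      using e False W insert.prems(2)
      by (simp add: bexp_insert insert.hyps all insert.IH algebra_simps)
  qed
qed

lemma bexp_all_on:
  assumes "finite A" "W \<subseteq> A" "\<And>e. e \<in> A \<Longrightarrow> 0 \<le> \<pi> e \<and> \<pi> e \<le> 1"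
  shows "bexp A \<pi> (all_on W) = (\<Prod>e\<in>W. \<pi> e)"
  using bexp_all_on_mult[OF assms, where g = "\<lambda>_. 1"] by simp

text \<open>A function of the coordinates outside \<open>W\<close> does not see the parameters on
  \<open>W\<close>, so it has the same mean before and after conditioning on
  \<open>W\<close>.\<close>

lemma bexp_off:
  assumes "finite A" "\<And>e. e \<in> A \<Longrightarrow> 0 \<le> \<pi> e \<and> \<pi> e \<le> 1 \<and> 0 \<le> \<rho> e \<and> \<rho> e \<le> 1"
    and "\<And>e. e \<in> A - W \<Longrightarrow> \<pi> e = \<rho> e"
  shows "bexp A \<pi> (\<lambda>\<omega>. g (\<lambda>e. \<omega> e \<and> e \<notin> W)) = bexp A \<rho> (\<lambda>\<omega>. g (\<lambda>e. \<omega> e \<and> e \<notin> W))"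
  using assms
proof (induction A arbitrary: g rule: finite_induct)
  case empty
  then show ?case by (simp add: bexp_empty)
next
  case (insert e A)
  have e: "0 \<le> \<pi> e" "\<pi> e \<le> 1" "0 \<le> \<rho> e" "\<rho> e \<le> 1" using insert.prems by auto
  have eq: "(\<lambda>x. (\<omega> (e := b)) x \<and> x \<notin> W) = (\<lambda>x. \<omega> x \<and> x \<notin> W)(e := b \<and> e \<notin> W)" for \<omega> b
    by auto
  have IH: "bexp A \<pi> (\<lambda>\<omega>. g ((\<lambda>x. \<omega> x \<and> x \<notin> W)(e := b))) = bexp A \<rho> (\<lambda>\<omega>. g ((\<lambda>x. \<omega> x \<and> x \<notin> W)(e := b)))" for b
    using insert.IH[of "\<lambda>\<omega>. g (\<omega> (e := b))"] insert.prems by auto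
  show ?case
    using insert.prems(2)[of e] insert.hyps e
    by (cases "e \<in> W") (simp_all add: bexp_insert eq IH algebra_simps del: fun_upd_apply)
qed

section \<open>Resampling and noise\<close>

definition resample :: "('e \<Rightarrow> bool) \<Rightarrow> ('e \<Rightarrow> bool) \<Rightarrow> ('e \<Rightarrow> bool) \<Rightarrow> ('e \<Rightarrow> bool)" where
  "resample r \<eta> \<omega> = (\<lambda>e. if r e then \<eta> e else \<omega> e)"

lemma resample_upd: "resample (r(e := a)) (\<eta>(e := b)) (\<omega> (e := c)) = (resample r \<eta> \<omega>)(e := if a then b else c)"
  by (auto simp: resample_def fun_eq_iff)

lemma resample_upd': "resample r (\<eta>(e := b)) (\<omega> (e := c)) = (resample r \<eta> \<omega>)(e := if r e then b else c)"
  by (auto simp: resample_def fun_eq_iff)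

lemma resample_resample: "resample r \<eta>' (resample r \<eta> \<omega>) = resample r \<eta>' \<omega>"
  by (auto simp: resample_def fun_eq_iff)

text \<open>For fixed \<open>r\<close>, mixing two independent samples along \<open>r\<close> gives
  a sample again. This invariance is what makes resampling a conditional expectation.\<close>

lemma bexp_resample:
  assumes "finite A" "\<And>e. e \<in> A \<Longrightarrow> 0 \<le> \<pi> e \<and> \<pi> e \<le> 1"
  shows "bexp A \<pi> (\<lambda>\<omega>. bexp A \<pi> (\<lambda>\<eta>. g (resample r \<eta> \<omega>))) = bexp A \<pi> g"
  using assms
proof (induction A arbitrary: g rule: finite_induct)
  case empty
  then show ?case by (simp add: bexp_empty resample_def)
next
  case (insert e A)
  have e: "0 \<le> \<pi> e" "\<pi> e \<le> 1" using insert.prems by auto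
  have IH: "bexp A \<pi> (\<lambda>\<omega>. bexp A \<pi> (\<lambda>\<eta>. g ((resample r \<eta> \<omega>)(e := b)))) = bexp A \<pi> (\<lambda>\<omega>. g (\<omega> (e := b)))" for b
    using insert.IH[of "\<lambda>\<omega>. g (\<omega> (e := b))"] insert.prems by auto
  show ?case
    using insert.hyps e
    by (cases "r e") (simp_all add: bexp_insert resample_upd' bexp_add bexp_cmult IH algebra_simps(1,2) flip: distrib_right)
qed

text \<open>Coordinates stay independent under noise, and each one is either kept or refreshed from
  \<open>\<rho>\<close>. So noise applied to a product measure only changes the parameters.\<close>

lemma bexp_noise:
  assumes "finite A" "\<And>e. e \<in> A \<Longrightarrow> 0 \<le> \<pi> e \<and> \<pi> e \<le> 1 \<and> 0 \<le> \<epsilon> e \<and> \<epsilon> e \<le> 1 \<and> 0 \<le> \<rho> e \<and> \<rho> e \<le> 1"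
  shows "bexp A \<pi> (\<lambda>\<omega>. bexp A \<epsilon> (\<lambda>r. bexp A \<rho> (\<lambda>\<eta>. g (resample r \<eta> \<omega>))))
    = bexp A (\<lambda>e. (1 - \<epsilon> e) * \<pi> e + \<epsilon> e * \<rho> e) g"
  using assms
proof (induction A arbitrary: g rule: finite_induct)
  case empty
  then show ?case by (simp add: bexp_empty resample_def)
next
  case (insert e A)
  have e: "0 \<le> \<pi> e" "\<pi> e \<le> 1" "0 \<le> \<epsilon> e" "\<epsilon> e \<le> 1" "0 \<le> \<rho> e" "\<rho> e \<le> 1" using insert.prems by auto
  let ?\<tau> = "\<lambda>e. (1 - \<epsilon> e) * \<pi> e + \<epsilon> e * \<rho> e"
  have \<tau>: "0 \<le> ?\<tau> e" "?\<tau> e \<le> 1" using e convex_bound_le[of "\<pi> e" 1 "\<rho> e" "1 - \<epsilon> e" "\<epsilon> e"] by auto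
  have IH: "bexp A \<pi> (\<lambda>\<omega>. bexp A \<epsilon> (\<lambda>r. bexp A \<rho> (\<lambda>\<eta>. g ((resample r \<eta> \<omega>)(e := b)))))
      = bexp A ?\<tau> (\<lambda>\<omega>. g (\<omega> (e := b)))" for b
    using insert.IH[of "\<lambda>\<omega>. g (\<omega> (e := b))"] insert.prems by auto
  show ?case
    using insert.hyps e \<tau>
    by (simp add: bexp_insert resample_upd bexp_add bexp_cmult IH) (simp add: algebra_simps)
qed

section \<open>Correlations under noise\<close>

definition noise_exp ::
    "'e set \<Rightarrow> real \<Rightarrow> real \<Rightarrow> (('e \<Rightarrow> bool) \<Rightarrow> ('e \<Rightarrow> bool) \<Rightarrow> real) \<Rightarrow> real" where
  "noise_exp A p \<epsilon> h = bexp A (\<lambda>_. p) (\<lambda>\<omega>. bexp A (\<lambda>_. \<epsilon>) (\<lambda>r. bexp A (\<lambda>_. p) (\<lambda>\<eta>. h \<omega> (resample r \<eta> \<omega>))))"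

lemma prob_pmf_expectation: "\<P>(x in measure_pmf M. P x) = measure_pmf.expectation M (\<lambda>x. of_bool (P x))"
proof -
  have "(\<lambda>x. of_bool (P x) :: real) = indicator {x. P x}" by (auto simp: indicator_def)
  then show ?thesis by simp
qed

lemma prob_true_bexp: "prob_true A p f = bexp A (\<lambda>_. p) (\<lambda>\<omega>. of_bool (f \<omega>))"
  by (simp only: prob_true_def prob_pmf_expectation bexp_def bernoulli_product_def)

lemma prob_noise_pair:
  assumes "finite A"
  shows "\<P>(x in measure_pmf (noise_pair A p \<epsilon>). Q x)
    = noise_exp A p \<epsilon> (\<lambda>\<omega> \<omega>'. of_bool (Q (\<omega>, \<omega>')))"
proof -
  have fin: "finite (set_pmf (bernoulli_product A q))" for q
    using assms by (simp add: bernoulli_product_def finite_set_bernoulli_product)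
  have b: "measure_pmf.expectation (bernoulli_product A q) g = bexp A (\<lambda>_. q) g" for q g
    by (simp add: bexp_def bernoulli_product_def)
  show ?thesis
    unfolding prob_pmf_expectation noise_pair_def noise_exp_def
    by (simp add: expectation_bind_finite fin b resample_def cong: if_cong)
qed

abbreviation noise_corr ::
    "'e set \<Rightarrow> real \<Rightarrow> real \<Rightarrow> (('e \<Rightarrow> bool) \<Rightarrow> real) \<Rightarrow> (('e \<Rightarrow> bool) \<Rightarrow> real) \<Rightarrow> real" where
  "noise_corr A p \<epsilon> u v \<equiv> noise_exp A p \<epsilon> (\<lambda>\<omega> \<omega>'. u \<omega> * v \<omega>')"

locale bernoulli_cube =
  fixes A :: "'e set" and p :: real
  assumes finite_A: "finite A" and p_range: "0 \<le> p" "p \<le> 1"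
begin

abbreviation E :: "(('e \<Rightarrow> bool) \<Rightarrow> real) \<Rightarrow> real" where "E \<equiv> bexp A (\<lambda>_. p)"

text \<open>For fixed \<open>r\<close>, averaging over \<open>\<eta>\<close> is the conditional
  expectation given the coordinates not marked by \<open>r\<close>, a self-adjoint projection.
  Averaging over \<open>r\<close> exhibits the noise form as a mixture of inner products of
  projections, from which symmetry and positivity are read off.\<close>

lemma noise_corr_eq:
  "noise_corr A p \<epsilon> u v = bexp A (\<lambda>_. \<epsilon>) (\<lambda>r. E (\<lambda>\<omega>. E (\<lambda>\<eta>. u (resample r \<eta> \<omega>)) * E (\<lambda>\<eta>. v (resample r \<eta> \<omega>))))"
proof -
  have "E (\<lambda>\<omega>. E (\<lambda>\<eta>. u \<omega> * v (resample r \<eta> \<omega>)))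
      = E (\<lambda>\<omega>. E (\<lambda>\<eta>. u (resample r \<eta> \<omega>)) * E (\<lambda>\<eta>. v (resample r \<eta> \<omega>)))" for r
  proof -
    have "E (\<lambda>\<omega>. E (\<lambda>\<eta>. u \<omega> * v (resample r \<eta> \<omega>))) = E (\<lambda>\<omega>. u \<omega> * E (\<lambda>\<eta>. v (resample r \<eta> \<omega>)))"
      by (simp add: bexp_cmult)
    \<comment> \<open>\<open>\<omega>\<close> is resampled by invariance; the inner factor ignores
      this because its own resampling overwrites the same coordinates.\<close>
    also have "\<dots> = E (\<lambda>\<omega>. E (\<lambda>\<eta>. u (resample r \<eta> \<omega>) * E (\<lambda>\<eta>'. v (resample r \<eta>' (resample r \<eta> \<omega>)))))"
      using p_range finite_A
      by (subst bexp_resample[where r = r and \<pi> = "\<lambda>_. p" and g = "\<lambda>\<omega>. u \<omega> * E (\<lambda>\<eta>. v (resample r \<eta> \<omega>))"]) auto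
    also have "\<dots> = E (\<lambda>\<omega>. E (\<lambda>\<eta>. u (resample r \<eta> \<omega>)) * E (\<lambda>\<eta>. v (resample r \<eta> \<omega>)))"
      by (simp add: resample_resample bexp_cmult mult.commute[of "u _"] mult.commute[of "bexp _ _ (\<lambda>\<eta>. u (resample r \<eta> _))"])
    finally show ?thesis .
  qed
  then show ?thesis
    unfolding noise_exp_def by (subst bexp_swap[OF finite_A finite_A]) simp
qed

lemma noise_corr_commute: "noise_corr A p \<epsilon> u v = noise_corr A p \<epsilon> v u"
  unfolding noise_corr_eq[of \<epsilon> u v] noise_corr_eq[of \<epsilon> v u] by (simp add: mult.commute)

lemma noise_corr_nonneg: "0 \<le> noise_corr A p \<epsilon> u u"
  unfolding noise_corr_eq by (intro bexp_nonneg finite_A) auto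

lemma noise_corr_left: "noise_corr A p \<epsilon> u (\<lambda>_. c) = c * E u"
  unfolding noise_exp_def by (simp add: bexp_cmult mult.commute)

lemma noise_corr_right: "noise_corr A p \<epsilon> (\<lambda>_. c) u = c * E u"
  by (subst noise_corr_commute) (rule noise_corr_left)

lemma noise_corr_diff_scale:
  "noise_corr A p \<epsilon> (\<lambda>\<omega>. u \<omega> - t * v \<omega>) w = noise_corr A p \<epsilon> u w - t * noise_corr A p \<epsilon> v w"
  unfolding noise_exp_def
  by (simp add: algebra_simps bexp_diff finite_A flip: bexp_cmult)

lemma noise_corr_diff_scale':
  "noise_corr A p \<epsilon> w (\<lambda>\<omega>. u \<omega> - t * v \<omega>) = noise_corr A p \<epsilon> w u - t * noise_corr A p \<epsilon> w v"
  by (simp only: noise_corr_commute[of \<epsilon> w] noise_corr_diff_scale)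

lemma noise_corr_sum_left:
  "noise_corr A p \<epsilon> (\<lambda>\<omega>. \<Sum>i\<in>I. u i \<omega>) w = (\<Sum>i\<in>I. noise_corr A p \<epsilon> (u i) w)"
  unfolding noise_exp_def
  by (simp add: sum_distrib_right bexp_sum finite_A)

lemma noise_exp_fst: "noise_exp A p \<epsilon> (\<lambda>\<omega> \<omega>'. u \<omega>) = E u"
  by (simp add: noise_exp_def)

lemma noise_exp_mono: "(\<And>\<omega> \<omega>'. g \<omega> \<omega>' \<le> h \<omega> \<omega>') \<Longrightarrow> noise_exp A p \<epsilon> g \<le> noise_exp A p \<epsilon> h"
  unfolding noise_exp_def by (intro bexp_mono finite_A)

lemma noise_exp_add: "noise_exp A p \<epsilon> (\<lambda>\<omega> \<omega>'. g \<omega> \<omega>' + h \<omega> \<omega>') = noise_exp A p \<epsilon> g + noise_exp A p \<epsilon> h"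
  unfolding noise_exp_def by (simp add: bexp_add finite_A)

lemma noise_exp_cmult: "noise_exp A p \<epsilon> (\<lambda>\<omega> \<omega>'. c * g \<omega> \<omega>') = c * noise_exp A p \<epsilon> g"
  unfolding noise_exp_def by (simp add: bexp_cmult)

lemma noise_corr_self_le: "noise_corr A p \<epsilon> v v \<le> E (\<lambda>\<omega>. (v \<omega>)\<^sup>2)"
proof -
  have "noise_corr A p \<epsilon> v v \<le> noise_exp A p \<epsilon> (\<lambda>\<omega> \<omega>'. (1/2) * ((v \<omega>)\<^sup>2) + (1/2) * (v \<omega>')\<^sup>2)"
  proof (rule noise_exp_mono)
    fix \<omega> \<omega>' show "v \<omega> * v \<omega>' \<le> (1/2) * ((v \<omega>)\<^sup>2) + (1/2) * (v \<omega>')\<^sup>2"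
      using zero_le_power2[of "v \<omega> - v \<omega>'"] by (simp add: power2_eq_square algebra_simps)
  qed
  also have "\<dots> = E (\<lambda>\<omega>. (v \<omega>)\<^sup>2)"
  proof -
    have "noise_exp A p \<epsilon> (\<lambda>\<omega> \<omega>'. (v \<omega>')\<^sup>2) = E (\<lambda>\<omega>. (v \<omega>)\<^sup>2)"
      using noise_corr_right[of \<epsilon> 1 "\<lambda>\<omega>. (v \<omega>)\<^sup>2"] by simp
    then show ?thesis
      unfolding noise_exp_add noise_exp_cmult noise_exp_fst by simp
  qed
  finally show ?thesis .
qed

text \<open>The noise operator is positive semidefinite, so a test function correlated with the noisy
  version of \<open>u\<close> bounds the autocorrelation of \<open>u\<close> from below (Cauchy--Schwarz).\<close>

lemma noise_corr_test_function:
  assumes "0 \<le> c" "0 < M" "c \<le> noise_corr A p \<epsilon> v u - E u * E v" "E (\<lambda>\<omega>. (v \<omega>)\<^sup>2) \<le> M"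
  shows "c\<^sup>2 / M \<le> noise_corr A p \<epsilon> u u - (E u)\<^sup>2"
proof -
  define u' v' where "u' = (\<lambda>\<omega>. u \<omega> - E u * 1)" and "v' = (\<lambda>\<omega>. v \<omega> - E v * 1)"
  have uu: "noise_corr A p \<epsilon> u' u' = noise_corr A p \<epsilon> u u - (E u)\<^sup>2"
    unfolding u'_def noise_corr_diff_scale noise_corr_diff_scale' noise_corr_left noise_corr_right
    by (simp add: power2_eq_square)
  have vu: "noise_corr A p \<epsilon> v' u' = noise_corr A p \<epsilon> v u - E u * E v"
    unfolding u'_def v'_def noise_corr_diff_scale noise_corr_diff_scale' noise_corr_left noise_corr_right
    by (simp add: algebra_simps)
  have "noise_corr A p \<epsilon> v' v' = noise_corr A p \<epsilon> v v - (E v)\<^sup>2"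
    unfolding v'_def noise_corr_diff_scale noise_corr_diff_scale' noise_corr_left noise_corr_right
    by (simp add: power2_eq_square)
  then have vv: "noise_corr A p \<epsilon> v' v' \<le> M"
    using noise_corr_self_le[of \<epsilon> v] assms by (smt (verit) zero_le_power2)
  \<comment> \<open>This \<open>t\<close> minimises \<open>- 2 * t * c + t * t * M\<close>, the
    bound obtained by expanding the form at \<open>u' - t * v'\<close>.\<close>
  define t where "t = c / M"
  have t: "0 \<le> t" "t * M = c" using assms by (auto simp: t_def)
  have "0 \<le> noise_corr A p \<epsilon> (\<lambda>\<omega>. u' \<omega> - t * v' \<omega>) (\<lambda>\<omega>. u' \<omega> - t * v' \<omega>)"
    by (rule noise_corr_nonneg)
  also have "\<dots> = noise_corr A p \<epsilon> u' u' - 2 * t * noise_corr A p \<epsilon> v' u' + t * t * noise_corr A p \<epsilon> v' v'"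
    unfolding noise_corr_diff_scale noise_corr_diff_scale' noise_corr_commute[of \<epsilon> u' v']
    by (simp add: algebra_simps)
  also have "\<dots> \<le> noise_corr A p \<epsilon> u' u' - 2 * t * c + t * t * M"
  proof -
    have "t * c \<le> t * noise_corr A p \<epsilon> v' u'"
      using t assms(3) by (intro mult_left_mono) (auto simp: vu)
    moreover have "t * t * noise_corr A p \<epsilon> v' v' \<le> t * t * M"
      using t vv by (intro mult_left_mono) auto
    ultimately show ?thesis by linarith
  qed
  also have "t * t * M = t * c" using t by (simp add: mult.assoc)
  finally have "t * c \<le> noise_corr A p \<epsilon> u' u'" by linarith
  then show ?thesis by (simp add: uu t_def power2_eq_square)
qed

lemma noise_corr_ge_square: "(E u)\<^sup>2 \<le> noise_corr A p \<epsilon> u u"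
  using noise_corr_test_function[of 0 "E (\<lambda>\<omega>. (0::real)\<^sup>2) + 1" \<epsilon> "\<lambda>_. 0" u]
  by (simp add: noise_corr_right[of \<epsilon> 0, simplified])

text \<open>Parameters of the configuration after noise, given that \<open>W\<close> was entirely
  open before: an edge of \<open>W\<close> is either kept or, with probability
  \<open>\<epsilon>\<close>, drawn again.\<close>

definition witness_law :: "real \<Rightarrow> 'e set \<Rightarrow> 'e \<Rightarrow> real" where
  "witness_law \<epsilon> W = (\<lambda>e. if e \<in> W then 1 - \<epsilon> + \<epsilon> * p else p)"

lemma witness_law_range:
  assumes "0 \<le> \<epsilon>" "\<epsilon> \<le> 1"
  shows "0 \<le> witness_law \<epsilon> W e" "witness_law \<epsilon> W e \<le> 1"
  using assms p_range mult_left_le[of p \<epsilon>] by (auto simp: witness_law_def)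

lemma noise_corr_all_on_mult:
  assumes "W \<subseteq> A" "0 \<le> \<epsilon>" "\<epsilon> \<le> 1"
  shows "noise_corr A p \<epsilon> (\<lambda>\<omega>. all_on W \<omega> * g \<omega>) v
    = p ^ card W * bexp A (\<lambda>e. if e \<in> W then 1 else p)
        (\<lambda>\<omega>. g \<omega> * bexp A (\<lambda>_. \<epsilon>) (\<lambda>r. E (\<lambda>\<eta>. v (resample r \<eta> \<omega>))))"
  unfolding noise_exp_def using assms p_range finite_A
  by (simp add: bexp_cmult mult.assoc bexp_all_on_mult)

lemma bexp_witness_law:
  assumes "0 \<le> \<epsilon>" "\<epsilon> \<le> 1"
  shows "bexp A (\<lambda>e. if e \<in> W then 1 else p) (\<lambda>\<omega>. bexp A (\<lambda>_. \<epsilon>) (\<lambda>r. E (\<lambda>\<eta>. v (resample r \<eta> \<omega>))))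
    = bexp A (witness_law \<epsilon> W) v"
  by (subst bexp_noise) (use assms finite_A p_range in \<open>auto intro!: bexp_cong simp: witness_law_def algebra_simps\<close>)

lemma noise_corr_all_on:
  assumes "W \<subseteq> A" "0 \<le> \<epsilon>" "\<epsilon> \<le> 1"
  shows "noise_corr A p \<epsilon> (all_on W) v = p ^ card W * bexp A (witness_law \<epsilon> W) v"
  using noise_corr_all_on_mult[OF assms, where g = "\<lambda>_. 1"] bexp_witness_law[OF assms(2,3)] by simp

lemma cond_prob_witness:
  assumes "W \<subseteq> A" "0 < p" "0 \<le> \<epsilon>" "\<epsilon> \<le> 1"
  shows "\<P>((\<omega>, \<omega>') in measure_pmf (noise_pair A p \<epsilon>). f \<omega>' \<bar> \<forall>e\<in>W. \<omega> e)
    = bexp A (witness_law \<epsilon> W) (\<lambda>\<omega>. of_bool (f \<omega>))"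
proof -
  have "\<P>((\<omega>, \<omega>') in measure_pmf (noise_pair A p \<epsilon>). f \<omega>' \<bar> \<forall>e\<in>W. \<omega> e)
      = noise_corr A p \<epsilon> (all_on W) (\<lambda>\<omega>. of_bool (f \<omega>)) / noise_corr A p \<epsilon> (all_on W) (\<lambda>_. 1)"
    unfolding cond_prob_def prob_noise_pair[OF finite_A]
    by (simp add: all_on_def conj_commute case_prod_unfold flip: of_bool_conj)
  also have "\<dots> = bexp A (witness_law \<epsilon> W) (\<lambda>\<omega>. of_bool (f \<omega>))"
    using assms p_range by (simp add: noise_corr_all_on noise_exp_fst bexp_all_on finite_A)
  finally show ?thesis .
qed

lemma cond_prob_noise:
  "\<P>((\<omega>, \<omega>') in measure_pmf (noise_pair A p \<epsilon>). f \<omega>' \<bar> f \<omega>)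
    = noise_corr A p \<epsilon> (\<lambda>\<omega>. of_bool (f \<omega>)) (\<lambda>\<omega>. of_bool (f \<omega>)) / E (\<lambda>\<omega>. of_bool (f \<omega>))"
proof -
  have "\<P>((\<omega>, \<omega>') in measure_pmf (noise_pair A p \<epsilon>). f \<omega>' \<bar> f \<omega>)
    = noise_corr A p \<epsilon> (\<lambda>\<omega>. of_bool (f \<omega>)) (\<lambda>\<omega>. of_bool (f \<omega>))
      / noise_corr A p \<epsilon> (\<lambda>\<omega>. of_bool (f \<omega>)) (\<lambda>_. 1)"
    unfolding cond_prob_def prob_noise_pair[OF finite_A]
    by (simp add: conj_commute case_prod_unfold flip: of_bool_conj)
  then show ?thesis by (simp add: noise_exp_fst)
qed

end

section \<open>Witnesses of increasing functions\<close>

lemma one_witness_exists: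
  assumes "finite A" "mono f" "\<omega> \<in> configs A" "f \<omega>"
  shows "\<exists>W\<in>one_witnesses A f. \<forall>e\<in>W. \<omega> e"
proof -
  let ?V = "{e\<in>A. \<omega> e}"
  let ?F = "{U. U \<subseteq> ?V \<and> forces_true A f U}"
  \<comment> \<open>By monotonicity the ones of \<open>\<omega>\<close> form a forcing set; a
    minimal forcing subset of it is the desired witness.\<close>
  have "forces_true A f ?V"
    unfolding forces_true_def
  proof (intro ballI impI)
    fix \<omega>' assume "\<omega>' \<in> configs A" "\<forall>e\<in>?V. \<omega>' e"
    then have "\<omega> \<le> \<omega>'" using assms(3) by (auto simp: le_fun_def configs_def PiE_dflt_def)
    then show "f \<omega>'" using monoD[OF assms(2)] assms(4) by auto
  qed
  moreover have "finite ?F" using assms(1) by auto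
  ultimately obtain W where W: "W \<in> ?F" "\<And>U. U \<in> ?F \<Longrightarrow> U \<subseteq> W \<Longrightarrow> W = U"
    using finite_has_minimal2[of ?F ?V] by auto
  have "\<not> forces_true A f V" if "V \<subset> W" for V
    using W(2)[of V] W(1) that by auto
  then have "W \<in> one_witnesses A f"
    using W(1) unfolding one_witnesses_def by auto
  then show ?thesis using W(1) by auto
qed

lemma one_witnessesD:
  assumes "W \<in> one_witnesses A f"
  shows "W \<subseteq> A" "\<And>\<omega>. \<omega> \<in> configs A \<Longrightarrow> \<forall>e\<in>W. \<omega> e \<Longrightarrow> f \<omega>"
    "\<And>V. V \<subset> W \<Longrightarrow> \<not> forces_true A f V"
  using assms by (auto simp: one_witnesses_def forces_true_def)

lemma finite_one_witnesses: "finite A \<Longrightarrow> finite (one_witnesses A f)"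
  by (rule finite_subset[of _ "Pow A"]) (auto simp: one_witnesses_def)

lemma bexp_mono_resample:
  fixes v :: "('e \<Rightarrow> bool) \<Rightarrow> real"
  assumes "finite A" "mono v"
  shows "mono (\<lambda>\<omega>. bexp A (\<lambda>_. \<epsilon>) (\<lambda>r. bexp A (\<lambda>_. p) (\<lambda>\<eta>. v (resample r \<eta> \<omega>))))"
  by (intro monoI bexp_mono assms monoD[OF assms(2)]) (auto simp: resample_def le_fun_def)

context bernoulli_cube begin

text \<open>Revealing which of finitely many witnesses is the first one present only adds decreasing
  information, which by Harris' inequality cannot help the increasing function \<open>v\<close>.\<close>

lemma noise_corr_exists_le:
  fixes v :: "('e \<Rightarrow> bool) \<Rightarrow> real"
  assumes "finite \<W>" "\<And>W. W \<in> \<W> \<Longrightarrow> W \<subseteq> A" "0 \<le> \<epsilon>" "\<epsilon> \<le> 1" "mono v"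
    and "\<And>W. W \<in> \<W> \<Longrightarrow> bexp A (witness_law \<epsilon> W) v \<le> M"
  shows "noise_corr A p \<epsilon> (\<lambda>\<omega>. of_bool (\<exists>W\<in>\<W>. \<forall>e\<in>W. \<omega> e)) v
    \<le> M * E (\<lambda>\<omega>. of_bool (\<exists>W\<in>\<W>. \<forall>e\<in>W. \<omega> e))"
  using assms(1,2,6)
proof (induction \<W> rule: finite_induct)
  case empty
  then show ?case using noise_corr_right[of \<epsilon> 0 v] by simp
next
  case (insert W \<W>)
  let ?F = "\<lambda>\<W> \<omega>. of_bool (\<exists>W\<in>\<W>. \<forall>e\<in>W. \<omega> e) :: real"
  \<comment> \<open>Minus the indicator that no earlier witness is present. In this form the factor
    is increasing, so Harris applies directly, and its sign turns the lower bound on the product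
    into an upper bound on the correlation.\<close>
  let ?h = "\<lambda>\<omega>. ?F \<W> \<omega> - 1"
  let ?\<pi> = "\<lambda>e. if e \<in> W then 1 else p"
  let ?T = "\<lambda>\<omega>. bexp A (\<lambda>_. \<epsilon>) (\<lambda>r. E (\<lambda>\<eta>. v (resample r \<eta> \<omega>)))"
  have split: "?F (insert W \<W>) \<omega> = ?F \<W> \<omega> - 1 * (all_on W \<omega> * ?h \<omega>)" for \<omega>
    by (auto simp: all_on_def)
  have W: "W \<subseteq> A" using insert.prems by auto
  have mono_h: "mono ?h" by (auto simp: mono_def le_fun_def)
  have "- M * bexp A ?\<pi> ?h \<ge> - bexp A ?\<pi> ?h * bexp A ?\<pi> ?T"
  proof -
    have "bexp A ?\<pi> ?h \<le> bexp A ?\<pi> (\<lambda>_. 0)" by (intro bexp_mono finite_A) auto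
    then have "- bexp A ?\<pi> ?h \<ge> 0" by simp
    moreover have "bexp A ?\<pi> ?T \<le> M"
      using insert.prems(2)[of W] assms by (simp add: bexp_witness_law)
    ultimately show ?thesis
      using mult_left_mono[of "bexp A ?\<pi> ?T" M "- bexp A ?\<pi> ?h"] by (simp add: mult.commute)
  qed
  moreover have "bexp A ?\<pi> ?h * bexp A ?\<pi> ?T \<le> bexp A ?\<pi> (\<lambda>\<omega>. ?h \<omega> * ?T \<omega>)"
    using finite_A p_range assms(5) mono_h by (intro bexp_Harris bexp_mono_resample) auto
  ultimately have "M * bexp A ?\<pi> ?h \<le> bexp A ?\<pi> (\<lambda>\<omega>. ?h \<omega> * ?T \<omega>)" by simp
  then have "p ^ card W * (M * bexp A ?\<pi> ?h) \<le> p ^ card W * bexp A ?\<pi> (\<lambda>\<omega>. ?h \<omega> * ?T \<omega>)"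
    using p_range by (intro mult_left_mono) auto
  then have step: "M * E (\<lambda>\<omega>. all_on W \<omega> * ?h \<omega>) \<le> noise_corr A p \<epsilon> (\<lambda>\<omega>. all_on W \<omega> * ?h \<omega>) v"
    unfolding noise_corr_all_on_mult[OF W assms(3,4)]
    using bexp_all_on_mult[OF finite_A W, of "\<lambda>_. p" ?h] p_range by (simp add: mult_ac)
  have IH: "noise_corr A p \<epsilon> (?F \<W>) v \<le> M * E (?F \<W>)"
    using insert.prems by (intro insert.IH) auto
  have "noise_corr A p \<epsilon> (?F (insert W \<W>)) v
      = noise_corr A p \<epsilon> (?F \<W>) v - noise_corr A p \<epsilon> (\<lambda>\<omega>. all_on W \<omega> * ?h \<omega>) v"
    unfolding split noise_corr_diff_scale by simp
  also have "\<dots> \<le> M * E (?F \<W>) - M * E (\<lambda>\<omega>. all_on W \<omega> * ?h \<omega>)"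
    using IH step by linarith
  also have "\<dots> = M * E (?F (insert W \<W>))"
    unfolding split by (simp add: bexp_diff finite_A right_diff_distrib del: of_bool_def)
  finally show ?case .
qed

lemma noise_corr_le_witness:
  assumes "mono f" "0 \<le> \<epsilon>" "\<epsilon> \<le> 1"
    and "\<And>W. W \<in> one_witnesses A f \<Longrightarrow> bexp A (witness_law \<epsilon> W) (\<lambda>\<omega>. of_bool (f \<omega>)) \<le> M"
  shows "noise_corr A p \<epsilon> (\<lambda>\<omega>. of_bool (f \<omega>)) (\<lambda>\<omega>. of_bool (f \<omega>)) \<le> M * E (\<lambda>\<omega>. of_bool (f \<omega>))"
proof -
  have eq: "of_bool (\<exists>W\<in>one_witnesses A f. \<forall>e\<in>W. \<omega> e) = (of_bool (f \<omega>) :: real)" if "\<omega> \<in> configs A" for \<omega>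
    using one_witness_exists[OF finite_A assms(1) that] one_witnessesD(2)[OF _ that] by auto
  have mono: "mono (\<lambda>\<omega>. of_bool (f \<omega>) :: real)"
    using assms(1) by (auto simp: mono_def)
  have 1: "E (\<lambda>\<omega>. of_bool (f \<omega>)) = E (\<lambda>\<omega>. of_bool (\<exists>W\<in>one_witnesses A f. \<forall>e\<in>W. \<omega> e))"
    by (intro bexp_cong finite_A refl eq[symmetric])
  have 2: "noise_corr A p \<epsilon> (\<lambda>\<omega>. of_bool (f \<omega>)) (\<lambda>\<omega>. of_bool (f \<omega>))
      = noise_corr A p \<epsilon> (\<lambda>\<omega>. of_bool (\<exists>W\<in>one_witnesses A f. \<forall>e\<in>W. \<omega> e)) (\<lambda>\<omega>. of_bool (f \<omega>))"
    unfolding noise_exp_def by (intro bexp_cong finite_A refl) (simp add: eq)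
  show ?thesis
    unfolding 1 2 using assms mono
    by (intro noise_corr_exists_le finite_one_witnesses finite_A) (auto dest: one_witnessesD(1))
qed

lemma bexp_off_eq:
  assumes "0 \<le> \<epsilon>" "\<epsilon> \<le> 1"
  shows "bexp A (witness_law \<epsilon> W) (\<lambda>\<omega>. g (\<lambda>e. \<omega> e \<and> e \<notin> W)) = E (\<lambda>\<omega>. g (\<lambda>e. \<omega> e \<and> e \<notin> W))"
  using assms witness_law_range[OF assms] p_range
  by (intro bexp_off finite_A) (auto simp: witness_law_def)

text \<open>\<open>b\<close> pays for the configurations in which \<open>f\<close> holds only with
  the help of \<open>W\<close>. With \<open>W\<close> erased the law is the unconditioned one, and
  erasing edges can only decrease an increasing \<open>f\<close>.\<close>

lemma bexp_witness_law_le: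
  assumes "mono f" "0 \<le> \<epsilon>" "\<epsilon> \<le> 1"
    and "\<And>\<omega>. \<omega> \<in> configs A \<Longrightarrow> f \<omega> \<Longrightarrow> f (\<lambda>e. \<omega> e \<and> e \<notin> W) \<or> 1 \<le> (b \<omega> :: real)"
    and "\<And>\<omega>. 0 \<le> b \<omega>"
  shows "bexp A (witness_law \<epsilon> W) (\<lambda>\<omega>. of_bool (f \<omega>)) \<le> E (\<lambda>\<omega>. of_bool (f \<omega>)) + bexp A (witness_law \<epsilon> W) b"
proof -
  have "bexp A (witness_law \<epsilon> W) (\<lambda>\<omega>. of_bool (f \<omega>))
      \<le> bexp A (witness_law \<epsilon> W) (\<lambda>\<omega>. of_bool (f (\<lambda>e. \<omega> e \<and> e \<notin> W)) + b \<omega>)"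
    using assms(4,5) by (intro bexp_mono finite_A) (fastforce simp: of_bool_def)
  also have "\<dots> = E (\<lambda>\<omega>. of_bool (f (\<lambda>e. \<omega> e \<and> e \<notin> W))) + bexp A (witness_law \<epsilon> W) b"
    using bexp_off_eq[OF assms(2,3), of W "\<lambda>\<omega>. of_bool (f \<omega>)"] by (simp add: bexp_add finite_A del: of_bool_def)
  also have "E (\<lambda>\<omega>. of_bool (f (\<lambda>e. \<omega> e \<and> e \<notin> W))) \<le> E (\<lambda>\<omega>. of_bool (f \<omega>))"
  proof (intro bexp_mono finite_A)
    fix \<omega> have "f (\<lambda>e. \<omega> e \<and> e \<notin> W) \<le> f \<omega>" by (intro monoD[OF assms(1)]) (auto simp: le_fun_def)
    then show "of_bool (f (\<lambda>e. \<omega> e \<and> e \<notin> W)) \<le> (of_bool (f \<omega>) :: real)" by auto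
  qed
  finally show ?thesis by simp
qed

text \<open>There are two independent ways to satisfy \<open>f\<close>: \<open>W\<close> survives
  the noise, or \<open>f\<close> holds with \<open>W\<close> erased. They depend on disjoint
  coordinates, so the probability of failing both is a product. Under the unconditioned law, erasing
  \<open>W\<close> matters only if some edge of \<open>W\<close> is open, whence the error
  \<open>card W * p\<close>.\<close>

lemma bexp_witness_law_ge:
  assumes "mono f" "0 \<le> \<epsilon>" "\<epsilon> \<le> 1" "W \<subseteq> A" "\<And>\<omega>. \<omega> \<in> configs A \<Longrightarrow> \<forall>e\<in>W. \<omega> e \<Longrightarrow> f \<omega>"
  defines "P \<equiv> E (\<lambda>\<omega>. of_bool (f \<omega>))"
  shows "P + (1 - \<epsilon>) ^ card W * (1 - P) - card W * p \<le> bexp A (witness_law \<epsilon> W) (\<lambda>\<omega>. of_bool (f \<omega>))"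
proof -
  let ?H = "\<lambda>\<omega>. of_bool (f (\<lambda>e. \<omega> e \<and> e \<notin> W)) :: real"
  let ?F = "\<lambda>\<omega>. of_bool (f \<omega>) :: real"
  let ?L = "witness_law \<epsilon> W"
  define h where "h = E ?H"
  define Q where "Q = (1 - \<epsilon> + \<epsilon> * p) ^ card W"
  define c where "c = (1 - \<epsilon>) ^ card W"
  have le: "f (\<lambda>e. \<omega> e \<and> e \<notin> W) \<Longrightarrow> f \<omega>" for \<omega>
    using monoD[OF assms(1), of "\<lambda>e. \<omega> e \<and> e \<notin> W" \<omega>] by (auto simp: le_fun_def)
  have finW: "finite W" using assms(4) finite_A finite_subset by blast
  have "bexp A ?L (\<lambda>\<omega>. all_on W \<omega> + (?H \<omega> - all_on W \<omega> * ?H \<omega>)) \<le> bexp A ?L ?F"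
    using assms(5) le by (intro bexp_mono finite_A) (auto simp: all_on_def)
  moreover have "bexp A ?L (\<lambda>\<omega>. all_on W \<omega> + (?H \<omega> - all_on W \<omega> * ?H \<omega>)) = Q + (h - Q * h)"
  proof -
    have 1: "bexp A ?L ?H = h"
      unfolding h_def using bexp_off_eq[OF assms(2,3), of W ?F] by simp
    have 2: "bexp A (\<lambda>e. if e \<in> W then 1 else ?L e) ?H = h"
      unfolding h_def
      using bexp_off[OF finite_A, of "\<lambda>e. if e \<in> W then 1 else ?L e" "\<lambda>_. p" W ?F]
        witness_law_range[OF assms(2,3)] p_range by (auto simp: witness_law_def)
    have 3: "(\<Prod>e\<in>W. ?L e) = Q" by (simp add: witness_law_def Q_def)
    show ?thesis
      unfolding bexp_add[OF finite_A] bexp_diff[OF finite_A] 1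
      using witness_law_range[OF assms(2,3)]
      by (subst bexp_all_on bexp_all_on_mult; (intro finite_A assms(4) conjI | assumption)?)
         (auto simp: 2 3 bexp_all_on_mult finite_A assms(4))
  qed
  ultimately have a: "Q + (h - Q * h) \<le> bexp A ?L ?F" by simp
  have h1: "h \<le> 1" 
    unfolding h_def using bexp_mono[OF finite_A, of ?H "\<lambda>_. 1"] by simp
  have cQ: "c \<le> Q" unfolding c_def Q_def using assms p_range by (intro power_mono) auto
  have c01: "0 \<le> c" "c \<le> 1" unfolding c_def using assms by (auto simp: power_le_one)
  have "P \<le> E (\<lambda>\<omega>. ?H \<omega> + (\<Sum>e\<in>W. all_on {e} \<omega>))"
    unfolding P_def
  proof (intro bexp_mono finite_A)
    fix \<omega>
    show "?F \<omega> \<le> ?H \<omega> + (\<Sum>e\<in>W. all_on {e} \<omega>)"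
    proof (cases "\<exists>e\<in>W. \<omega> e")
      case True
      then obtain e where "e \<in> W" "\<omega> e" by auto
      then have "1 \<le> (\<Sum>e\<in>W. all_on {e} \<omega>)"
        using member_le_sum[of e W "\<lambda>e. all_on {e} \<omega>"] finW by (auto simp: all_on_def)
      then show ?thesis by (auto simp: of_bool_def)
    next
      case False
      then have "(\<lambda>e. \<omega> e \<and> e \<notin> W) = \<omega>" by auto
      then show ?thesis by (auto simp: all_on_def intro!: sum_nonneg)
    qed
  qed
  also have "\<dots> = h + card W * p"
    using assms(4) p_range
    by (simp add: bexp_add finite_A bexp_sum h_def bexp_all_on subset_iff del: of_bool_def)
  finally have hP: "P - card W * p \<le> h" by simp
  have "c * (1 - h) \<le> Q * (1 - h)" using cQ h1 by (intro mult_right_mono) auto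
  then have "h + c * (1 - h) \<le> bexp A ?L ?F" using a by (simp add: algebra_simps)
  moreover have "(1 - c) * (P - card W * p) \<le> (1 - c) * h" using c01 hP by (intro mult_left_mono) auto
  moreover have "0 \<le> c * (card W * p)" using c01 p_range by (intro mult_nonneg_nonneg) auto
  ultimately show ?thesis unfolding c_def[symmetric] by (simp add: algebra_simps)
qed

end

section \<open>Cycles as lists of vertices\<close>

fun path_edges :: "'a list \<Rightarrow> 'a set list" where
  "path_edges (x # y # zs) = {x, y} # path_edges (y # zs)"
| "path_edges _ = []"

definition cycle_edges :: "'a list \<Rightarrow> 'a set list" where
  "cycle_edges vs = path_edges (vs @ [hd vs])"

lemma length_path_edges [simp]: "length (path_edges vs) = length vs - 1"
  by (induction vs rule: path_edges.induct) auto

lemma length_cycle_edges [simp]: "length (cycle_edges vs) = length vs"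
  by (simp add: cycle_edges_def)

lemma nth_path_edges: "Suc i < length vs \<Longrightarrow> path_edges vs ! i = {vs ! i, vs ! Suc i}"
  by (induction vs arbitrary: i rule: path_edges.induct) (auto simp: nth_Cons split: nat.splits)

lemma nth_cycle_edges:
  assumes "i < length vs"
  shows "cycle_edges vs ! i = {vs ! i, vs ! (Suc i mod length vs)}"
proof -
  have "hd vs = vs ! 0" using assms by (cases vs) auto
  then show ?thesis
    using assms by (cases "Suc i = length vs") (auto simp: cycle_edges_def nth_path_edges nth_append)
qed

lemma path_edges_snoc: "vs \<noteq> [] \<Longrightarrow> path_edges (vs @ [x]) = path_edges vs @ [{last vs, x}]"
  by (induction vs rule: path_edges.induct) auto

lemma cycle_edges_rotate1: "cycle_edges (rotate1 vs) = rotate1 (cycle_edges vs)"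
proof (cases vs)
  case (Cons x xs)
  then show ?thesis
    using path_edges_snoc[of "xs @ [x]" "hd xs"]
    by (cases xs) (auto simp: cycle_edges_def)
qed (simp add: cycle_edges_def)

lemma cycle_edges_rotate: "cycle_edges (rotate i vs) = rotate i (cycle_edges vs)"
  by (induction i) (simp_all add: cycle_edges_rotate1)

lemma path_edges_subset: "e \<in> set (path_edges vs) \<Longrightarrow> e \<subseteq> set vs"
  by (induction vs rule: path_edges.induct) auto

lemma cycle_edges_subset: "e \<in> set (cycle_edges vs) \<Longrightarrow> e \<subseteq> set vs"
  using path_edges_subset[of e "vs @ [hd vs]"]
  by (cases vs) (auto simp: cycle_edges_def)

lemma distinct_path_edges: "distinct vs \<Longrightarrow> distinct (path_edges vs)"
  by (induction vs rule: path_edges.induct) (auto dest: path_edges_subset)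

lemma card_path_edge: "distinct vs \<Longrightarrow> e \<in> set (path_edges vs) \<Longrightarrow> card e = 2"
  by (induction vs rule: path_edges.induct) (auto simp: card_insert_if)

lemma path_edges_last:
  "v \<notin> set us \<Longrightarrow> {v, x} \<in> set (path_edges (us @ [v])) \<Longrightarrow> us \<noteq> [] \<and> x = last us"
  by (induction us rule: path_edges.induct) (auto simp: doubleton_eq_iff)

lemma card_cycle_edge:
  assumes "distinct vs" "2 \<le> length vs" "e \<in> set (cycle_edges vs)"
  shows "card e = 2"
proof -
  obtain x y zs where vs: "vs = x # y # zs"
    using assms(2) by (auto simp: Suc_le_length_iff numeral_2_eq_2)
  then have "hd vs \<noteq> last vs"
    using assms(1) last_in_set[of "y # zs"] by (auto split: if_splits)
  moreover have "vs \<noteq> []" using vs by simp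
  ultimately show ?thesis
    using assms(1,3) by (auto simp: cycle_edges_def path_edges_snoc card_path_edge card_insert_if)
qed

text \<open>Length 3 is the threshold: a list of two vertices runs through its only edge
  twice.\<close>

lemma distinct_cycle_edges:
  assumes "distinct vs" "3 \<le> length vs"
  shows "distinct (cycle_edges vs)"
proof -
  obtain x y z zs where vs: "vs = x # y # z # zs"
    using assms(2) by (auto simp: Suc_le_length_iff numeral_3_eq_3)
  have "{x, y} \<notin> set (path_edges ((y # z # zs) @ [x]))"
  proof
    assume "{x, y} \<in> set (path_edges ((y # z # zs) @ [x]))"
    from path_edges_last[OF _ this] have "y = last (z # zs)" using assms(1) vs by auto
    then show False using assms(1) vs by (metis distinct.simps(2) last_in_set list.distinct(1) list.set_intros)
  qed
  moreover have "distinct (path_edges ((y # z # zs) @ [x]))"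
    using assms(1) vs by (intro distinct_path_edges) auto
  ultimately show ?thesis by (simp add: cycle_edges_def vs)
qed

text \<open>Rotating \<open>v\<close> to the front leaves only the second and the last vertex as
  possible neighbours.\<close>

lemma neighbours_cycle:
  assumes "distinct vs"
  shows "\<exists>a b. {x. {v, x} \<in> set (cycle_edges vs)} \<subseteq> {a, b}"
proof (cases "v \<in> set vs")
  case False
  then have "{v, x} \<notin> set (cycle_edges vs)" for x using cycle_edges_subset[of "{v, x}" vs] by blast
  then show ?thesis by auto
next
  case True
  then obtain i where i: "i < length vs" "vs ! i = v" by (auto simp: in_set_conv_nth)
  define us where "us = rotate i vs"
  have us: "distinct us" "set (cycle_edges us) = set (cycle_edges vs)" "us \<noteq> []" "hd us = v"
    using assms i hd_rotate_conv_nth[of vs i]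
    by (cases vs; simp add: us_def cycle_edges_rotate)+
  then obtain ys where ys: "us = v # ys" by (cases us) auto
  show ?thesis
  proof (cases ys)
    case Nil
    then have "{x. {v, x} \<in> set (cycle_edges vs)} \<subseteq> {v, v}"
      unfolding us(2)[symmetric] by (auto simp: ys cycle_edges_def doubleton_eq_iff)
    then show ?thesis by blast
  next
    case (Cons y zs)
    have "x \<in> {y, last ys}" if "{v, x} \<in> set (cycle_edges us)" for x
    proof -
      have "{v, x} = {v, y} \<or> {v, x} \<in> set (path_edges (ys @ [v]))"
        using that by (auto simp: ys Cons cycle_edges_def)
      then show ?thesis
        using path_edges_last[of v ys x] us(1) by (auto simp: ys doubleton_eq_iff)
    qed
    then show ?thesis unfolding us(2) by blast
  qed
qed

lemma card_neighbours_cycle: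
  assumes "distinct vs"
  shows "card {x. {v, x} \<in> set (cycle_edges vs)} \<le> 2"
proof -
  obtain a b where "{x. {v, x} \<in> set (cycle_edges vs)} \<subseteq> {a, b}"
    using neighbours_cycle[OF assms] by blast
  then have "card {x. {v, x} \<in> set (cycle_edges vs)} \<le> card {a, b}" by (intro card_mono) auto
  also have "\<dots> \<le> 2" by (simp add: card_insert_if)
  finally show ?thesis .
qed

lemma is_cycle_iff:
  "is_cycle n \<omega> vs \<longleftrightarrow> 3 \<le> length vs \<and> distinct vs \<and> set vs \<subseteq> {..<n} \<and> (\<forall>e\<in>set (cycle_edges vs). \<omega> e)"
  by (auto simp: is_cycle_def all_set_conv_all_nth nth_cycle_edges)

text \<open>A cyclic word with both kinds of entries has a place where \<open>P\<close> starts to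
  hold. Applied to the edges of a cycle and membership in \<open>W\<close>, this moves the starting
  point to the beginning of a run of \<open>W\<close>-edges.\<close>

lemma rotate_to_boundary:
  assumes "\<exists>x\<in>set xs. P x" "\<exists>x\<in>set xs. \<not> P x"
  shows "\<exists>i<length xs. P (hd (rotate i xs)) \<and> \<not> P (last (rotate i xs))"
proof -
  obtain as b bs where xs: "xs = as @ b # bs" "\<not> P b"
    using assms(2) by (meson split_list)
  \<comment> \<open>With a bad entry rotated to the front, the first good entry is sure to have a
    bad predecessor.\<close>
  define ys where "ys = rotate (length as) xs"
  have ys: "ys = b # bs @ as" by (simp add: ys_def xs(1) rotate_append)
  have "\<exists>x\<in>set (bs @ as). P x" using assms(1) xs by auto
  then obtain us z ws where z: "bs @ as = us @ z # ws" "P z" "\<forall>x\<in>set us. \<not> P x"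
    using split_list_first_prop[of "bs @ as" P] by auto
  have "ys = (b # us) @ (z # ws)" using ys z(1) by simp
  then have r: "rotate (length (b # us)) ys = (z # ws) @ (b # us)"
    by (simp only: rotate_append)
  have "\<not> P (last (b # us))" using z(3) xs(2) by (cases us rule: rev_cases) auto
  then have "P (hd (rotate (length (b # us)) ys))" "\<not> P (last (rotate (length (b # us)) ys))"
    unfolding r using z(2) by auto
  moreover have "rotate (length (b # us)) ys = rotate ((length (b # us) + length as) mod length xs) xs"
    unfolding ys_def rotate_rotate by (rule rotate_conv_mod)
  moreover have "(length (b # us) + length as) mod length xs < length xs" using xs by simp
  ultimately show ?thesis by metis
qed

text \<open>Weighted count of the simple cycles that use both edges of \<open>W\<close> (weight \<open>x\<close>) and other edges
  (weight \<open>y\<close>), where \<open>W\<close> has maximal degree two and meets only the vertices in \<open>V\<close>. A cycle is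
  explored step by step: inside a run of \<open>W\<close>-edges there is at most one way to continue in \<open>W\<close>,
  whereas starting a new run costs a visit to \<open>V\<close>.\<close>

locale degree_two_edges =
  fixes W :: "'a set set" and V U :: "'a set" and x y :: real
  assumes finite_V: "finite V" and finite_U: "finite U"
    and edge_V: "\<And>u v. {u, v} \<in> W \<Longrightarrow> u \<in> V"
    and degree: "\<And>v. card {u. {v, u} \<in> W} \<le> 2"
    and x: "0 \<le> x" "x < 1" and y: "0 \<le> y" "card U * y < 1"
begin

section \<open>Transfer recursion for weighted paths\<close>

definition weight :: "'a set \<Rightarrow> real" where "weight e = (if e \<in> W then x else y)"

abbreviation path_weight :: "'a list \<Rightarrow> real" where
  "path_weight vs \<equiv> prod_list (map weight (path_edges vs))"

abbreviation cycle_weight :: "'a list \<Rightarrow> real" where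
  "cycle_weight vs \<equiv> prod_list (map weight (cycle_edges vs))"

lemma weight_nonneg: "0 \<le> weight e"
  using x y by (simp add: weight_def)

lemma weights_nonneg: "0 \<le> prod_list (map weight es)"
  by (induction es) (auto intro!: mult_nonneg_nonneg weight_nonneg)

lemma finite_neighbours: "finite {u. {v, u} \<in> W}"
  by (rule finite_subset[OF _ finite_V]) (auto intro: edge_V simp: insert_commute)

text \<open>A path continues from \<open>v\<close>, having come from \<open>u\<close>, and is
  finally closed up to the root \<open>v0\<close> by an edge outside \<open>W\<close>. Of the
  vertices already visited only \<open>u\<close> and \<open>v\<close> are remembered: forgetting the
  others enlarges the sum, which is harmless for an upper bound, while \<open>u\<close> is kept to
  exclude stepping back along a \<open>W\<close>-edge.\<close>

definition paths :: "'a \<Rightarrow> nat \<Rightarrow> 'a \<Rightarrow> 'a \<Rightarrow> 'a list set" where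
  "paths v0 k u v = {xs. length xs = k \<and> set xs \<subseteq> U \<and> distinct (u # v # xs) \<and> {last (v # xs), v0} \<notin> W}"

definition path_sum :: "'a \<Rightarrow> nat \<Rightarrow> 'a \<Rightarrow> 'a \<Rightarrow> real" where
  "path_sum v0 k u v = (\<Sum>xs\<in>paths v0 k u v. path_weight (v # xs @ [v0]))"

lemma finite_paths: "finite (paths v0 k u v)"
  by (rule finite_subset[OF _ finite_lists_length_eq[OF finite_U, of k]]) (auto simp: paths_def)

lemma path_sum_Suc: "path_sum v0 (Suc k) u v \<le> (\<Sum>z\<in>U - {u}. weight {v, z} * path_sum v0 k v z)"
proof -
  let ?I = "SIGMA z:U - {u}. paths v0 k v z"
  let ?c = "\<lambda>(z, zs). z # zs"
  have sub: "paths v0 (Suc k) u v \<subseteq> ?c ` ?I"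
  proof
    fix xs assume "xs \<in> paths v0 (Suc k) u v"
    then show "xs \<in> ?c ` ?I"
      by (cases xs) (auto simp: paths_def image_iff)
  qed
  have fin: "finite ?I" using finite_U finite_paths by auto
  have "path_sum v0 (Suc k) u v \<le> (\<Sum>xs\<in>?c ` ?I. path_weight (v # xs @ [v0]))"
    unfolding path_sum_def using fin sub by (intro sum_mono2 weights_nonneg) auto
  also have "\<dots> \<le> (\<Sum>p\<in>?I. path_weight (v # ?c p @ [v0]))"
    using sum_image_le[OF fin, of "\<lambda>xs. path_weight (v # xs @ [v0])" ?c] weights_nonneg by auto
  also have "\<dots> = (\<Sum>z\<in>U - {u}. \<Sum>zs\<in>paths v0 k v z. weight {v, z} * path_weight (z # zs @ [v0]))"
    using finite_U finite_paths by (subst sum.Sigma) (auto simp: case_prod_unfold)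
  finally show ?thesis by (simp add: path_sum_def sum_distrib_left)
qed

text \<open>\<open>\<alpha>\<close> bounds the remaining sum after arriving by a
  \<open>W\<close>-edge, \<open>\<delta>\<close> after any other step, and \<open>\<gamma>\<close>
  is the surcharge when that other step lands in \<open>V\<close>, where a run can begin. Inside a
  run at most one \<open>W\<close>-edge leads on; at its beginning there are up to two, hence the
  factor 2. The initial values come from the closing edge, which has weight
  \<open>y\<close>.\<close>

primrec bounds :: "nat \<Rightarrow> real \<times> real \<times> real" where
  "bounds 0 = (y, y, 0)"
| "bounds (Suc k) = (case bounds k of (\<alpha>, \<delta>, \<gamma>) \<Rightarrow>
     (x * \<alpha> + y * (card U * \<delta> + card V * \<gamma>), y * (card U * \<delta> + card V * \<gamma>), 2 * x * \<alpha>))"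

definition "\<alpha> k = fst (bounds k)"
definition "\<delta> k = fst (snd (bounds k))"
definition "\<gamma> k = snd (snd (bounds k))"

lemma bounds_0: "\<alpha> 0 = y" "\<delta> 0 = y" "\<gamma> 0 = 0"
  by (auto simp: \<alpha>_def \<delta>_def \<gamma>_def)

lemma bounds_Suc:
  "\<alpha> (Suc k) = x * \<alpha> k + y * (card U * \<delta> k + card V * \<gamma> k)"
  "\<delta> (Suc k) = y * (card U * \<delta> k + card V * \<gamma> k)"
  "\<gamma> (Suc k) = 2 * x * \<alpha> k"
  by (auto simp: \<alpha>_def \<delta>_def \<gamma>_def case_prod_unfold)

lemma bounds_nonneg: "0 \<le> \<alpha> k \<and> 0 \<le> \<delta> k \<and> 0 \<le> \<gamma> k"
  using x y by (induction k) (auto simp: bounds_0 bounds_Suc intro!: add_nonneg_nonneg mult_nonneg_nonneg)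

lemma path_sum_le:
  "path_sum v0 k u v \<le> (if {u, v} \<in> W then \<alpha> k else \<delta> k + (if v \<in> V then \<gamma> k else 0))"
proof (induction k arbitrary: u v)
  case 0
  have "paths v0 0 u v \<subseteq> {[]}" by (auto simp: paths_def)
  then have "path_sum v0 0 u v \<le> y"
    using y by (cases "paths v0 0 u v = {}") (auto simp: path_sum_def subset_singleton_iff paths_def weight_def)
  then show ?case by (simp add: bounds_0)
next
  case (Suc k)
  note nn = bounds_nonneg[of k]
  let ?N = "{z. z \<noteq> u \<and> {v, z} \<in> W}"
  have "path_sum v0 (Suc k) u v \<le> (\<Sum>z\<in>U - {u}. weight {v, z} * path_sum v0 k v z)"
    by (rule path_sum_Suc)
  also have "\<dots> \<le> (\<Sum>z\<in>U - {u}. weight {v, z} * (if {v, z} \<in> W then \<alpha> k else \<delta> k + (if z \<in> V then \<gamma> k else 0)))"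
    using Suc.IH by (intro sum_mono mult_left_mono weight_nonneg) auto
  also have "\<dots> \<le> (\<Sum>z\<in>U - {u}. (if {v, z} \<in> W then x * \<alpha> k else 0) + y * (\<delta> k + (if z \<in> V then \<gamma> k else 0)))"
    using nn x y by (intro sum_mono) (auto simp: weight_def)
  also have "\<dots> = (\<Sum>z\<in>U - {u}. if {v, z} \<in> W then x * \<alpha> k else 0)
      + (\<Sum>z\<in>U - {u}. y * (\<delta> k + (if z \<in> V then \<gamma> k else 0)))"
    by (rule sum.distrib)
  also have "(\<Sum>z\<in>U - {u}. if {v, z} \<in> W then x * \<alpha> k else 0) \<le> card ?N * (x * \<alpha> k)"
  proof -
    have "(\<Sum>z\<in>U - {u}. if {v, z} \<in> W then x * \<alpha> k else 0) = card {z\<in>U - {u}. {v, z} \<in> W} * (x * \<alpha> k)"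
      using finite_U by (subst sum.inter_filter[symmetric]) auto
    also have "\<dots> \<le> card ?N * (x * \<alpha> k)"
      using nn x finite_subset[OF _ finite_neighbours[of v], of ?N]
      by (intro mult_right_mono of_nat_mono card_mono mult_nonneg_nonneg) auto
    finally show ?thesis .
  qed
  also have "(\<Sum>z\<in>U - {u}. y * (\<delta> k + (if z \<in> V then \<gamma> k else 0)))
      \<le> (\<Sum>z\<in>U. y * (\<delta> k + (if z \<in> V then \<gamma> k else 0)))"
    using nn y finite_U by (intro sum_mono2) auto
  also have "\<dots> = y * (card U * \<delta> k + card (U \<inter> V) * \<gamma> k)"
    using finite_U by (simp add: sum_distrib_left[symmetric] sum.distrib sum.If_cases Int_def)
  also have "\<dots> \<le> y * (card U * \<delta> k + card V * \<gamma> k)"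
    using nn y finite_V by (intro mult_left_mono add_left_mono mult_right_mono of_nat_mono card_mono) auto
  finally have main: "path_sum v0 (Suc k) u v \<le> card ?N * (x * \<alpha> k) + y * (card U * \<delta> k + card V * \<gamma> k)"
    by simp
  have xa: "0 \<le> x * \<alpha> k" using nn x by simp
  consider "{u, v} \<in> W" | "{u, v} \<notin> W" "v \<in> V" | "{u, v} \<notin> W" "v \<notin> V" by blast
  then show ?case
  proof cases
    case 1
    \<comment> \<open>\<open>u\<close> is itself a \<open>W\<close>-neighbour of \<open>v\<close>
      and is forbidden, so at most one way to stay in \<open>W\<close> remains.\<close>
    then have "?N \<subset> {z. {v, z} \<in> W}" by (auto simp: insert_commute)
    then have "card ?N < card {z. {v, z} \<in> W}" using finite_neighbours by (rule psubset_card_mono[rotated])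
    then have "card ?N \<le> 1" using degree[of v] by linarith
    then have "card ?N * (x * \<alpha> k) \<le> 1 * (x * \<alpha> k)" using xa by (intro mult_right_mono) auto
    then show ?thesis using main 1 by (simp add: bounds_Suc)
  next
    case 2
    have "card ?N \<le> card {z. {v, z} \<in> W}" using finite_neighbours by (intro card_mono) auto
    then have "card ?N \<le> 2" using degree[of v] by linarith
    then have "card ?N * (x * \<alpha> k) \<le> 2 * (x * \<alpha> k)" using xa by (intro mult_right_mono) auto
    then show ?thesis using main 2 by (simp add: bounds_Suc)
  next
    case 3
    then have "?N = {}" using edge_V by blast
    then have "card ?N = 0" by (simp only: card.empty)
    then show ?thesis using main 3 by (simp add: bounds_Suc)
  qed
qed

text \<open>Total weight of one more run and excursion over all lengths: a return to
  \<open>V\<close> (\<open>card V * y\<close>), a direction (2), and geometric series for the run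
  (\<open>x / (1 - x)\<close>) and for the excursion.\<close>

definition "\<kappa> = 2 * card V * x * y / ((1 - x) * (1 - card U * y))"

text \<open>The recursion is summed over \<open>k\<close>, and the sums of \<open>\<delta>\<close>
  and \<open>\<gamma>\<close> are eliminated. What remains says that
  \<open>(1 - x) * (1 - card U * y)\<close> times the sum of \<open>\<alpha>\<close> is at most
  \<open>y\<close> plus \<open>\<kappa>\<close> times itself; \<open>\<kappa> \<le> 1 / 2\<close>
  absorbs the last term at the price of the factor 2.\<close>

lemma sum_alpha_le:
  assumes "\<kappa> \<le> 1 / 2"
  shows "(\<Sum>k<K. \<alpha> k) \<le> 2 * y / ((1 - x) * (1 - card U * y))"
proof -
  define SA SD SG \<rho> where "SA = (\<Sum>k<K. \<alpha> k)" and "SD = (\<Sum>k<K. \<delta> k)" and "SG = (\<Sum>k<K. \<gamma> k)" 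
    and "\<rho> = card U * y"
  have \<rho>: "0 \<le> \<rho>" "\<rho> < 1" using y by (auto simp: \<rho>_def)
  have shift: "(\<Sum>k<K. s k) \<le> s 0 + (\<Sum>k<K. s (Suc k))" if "\<And>k. 0 \<le> s k" for s :: "nat \<Rightarrow> real"
    using sum.lessThan_Suc[of s K] that[of K] by (simp only: sum.lessThan_Suc_shift)
  have A: "SA \<le> y + (x * SA + (\<rho> * SD + y * card V * SG))"
    using shift[of \<alpha>] bounds_nonneg
    by (simp add: SA_def SD_def SG_def \<rho>_def bounds_0 bounds_Suc sum.distrib sum_distrib_left algebra_simps)
  have D: "SD \<le> y + (\<rho> * SD + y * card V * SG)"
    using shift[of \<delta>] bounds_nonneg
    by (simp add: SA_def SD_def SG_def \<rho>_def bounds_0 bounds_Suc sum.distrib sum_distrib_left algebra_simps)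
  have G: "SG \<le> 2 * x * SA"
    using shift[of \<gamma>] bounds_nonneg
    by (simp add: SA_def SD_def SG_def \<rho>_def bounds_0 bounds_Suc sum.distrib sum_distrib_left algebra_simps)
  have SA0: "0 \<le> SA" using bounds_nonneg by (auto simp: SA_def intro: sum_nonneg)
  have "y * card V * SG \<le> y * card V * (2 * x * SA)"
    using y G by (intro mult_left_mono) auto
  moreover define t where "t = y * card V * (2 * x * SA)"
  ultimately have G': "y * card V * SG \<le> t" by simp
  define c where "c = (1 - x) * (1 - \<rho>)"
  have c: "0 < c" using x \<rho> by (simp add: c_def)
  have "(1 - \<rho>) * (SA - x * SA) \<le> (1 - \<rho>) * (y + \<rho> * SD + t)"
    using A G' \<rho> by (intro mult_left_mono) auto
  moreover have "\<rho> * ((1 - \<rho>) * SD) \<le> \<rho> * (y + t)"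
    using D G' \<rho> by (intro mult_left_mono) (auto simp: algebra_simps)
  ultimately have "c * SA \<le> y + t"
    unfolding c_def by (simp add: algebra_simps)
  moreover have "t = \<kappa> * (c * SA)"
    using c unfolding t_def \<kappa>_def c_def[unfolded \<rho>_def, symmetric] by (simp add: mult_ac)
  moreover have "\<kappa> * (c * SA) \<le> 1 / 2 * (c * SA)"
    using assms c SA0 by (intro mult_right_mono) auto
  ultimately have "c * SA \<le> 2 * y" by linarith
  then show ?thesis
    using c unfolding SA_def[symmetric] c_def[unfolded \<rho>_def, symmetric] by (simp add: field_simps)
qed

section \<open>Weighted sums over cycles\<close>

definition oriented :: "('a \<times> 'a) set" where
  "oriented = {(u, v). {u, v} \<in> W}"

lemma oriented_Sigma: "oriented = (SIGMA u:V. {v. {u, v} \<in> W})"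
  by (auto simp: oriented_def dest: edge_V)

lemma finite_oriented: "finite oriented"
  unfolding oriented_Sigma using finite_V finite_neighbours by auto

lemma card_oriented_le: "card oriented \<le> 2 * card V"
proof -
  have "card oriented = (\<Sum>u\<in>V. card {v. {u, v} \<in> W})"
    unfolding oriented_Sigma using finite_V finite_neighbours by (intro card_SigmaI) auto
  also have "\<dots> \<le> (\<Sum>u\<in>V. 2)" using degree by (intro sum_mono) auto
  finally show ?thesis by simp
qed

text \<open>The list starts with the first edge of a run of \<open>W\<close>. Every cycle that mixes
  edges inside and outside \<open>W\<close> has such a rotation, so a union bound over these lists
  avoids a factor of the order of the length.\<close>

definition rooted_cycles :: "nat set \<Rightarrow> 'a list set" where
  "rooted_cycles L = {vs. length vs \<in> L \<and> distinct vs \<and> set vs \<subseteq> U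
     \<and> hd (cycle_edges vs) \<in> W \<and> last (cycle_edges vs) \<notin> W}"

text \<open>The first edge is one of at most \<open>2 * card V\<close> oriented edges of
  \<open>W\<close> and contributes \<open>x\<close>; the rest is a path entered along a
  \<open>W\<close>-edge, so the bound \<open>\<alpha>\<close> applies to it.\<close>

lemma rooted_cycles_sum:
  assumes "finite L" "\<And>m. m \<in> L \<Longrightarrow> 2 \<le> m" "\<kappa> \<le> 1 / 2"
  shows "(\<Sum>vs\<in>rooted_cycles L. cycle_weight vs) \<le> 2 * \<kappa>"
proof -
  define K where "K = Max (insert 0 L)"
  have K: "m \<le> K" if "m \<in> L" for m using assms(1) that by (auto simp: K_def)
  let ?P = "\<lambda>(k, p). paths (fst p) k (fst p) (snd p)"
  let ?I = "SIGMA q:{..<K} \<times> oriented. ?P q"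
  let ?c = "\<lambda>(q, xs). fst (snd q) # snd (snd q) # xs"
  have fin: "finite ?I" using finite_oriented finite_paths by auto
  have sub: "rooted_cycles L \<subseteq> ?c ` ?I"
  proof
    fix vs assume vs: "vs \<in> rooted_cycles L"
    then obtain u v xs where eq: "vs = u # v # xs"
      using assms(2)[of "length vs"] by (auto simp: rooted_cycles_def Suc_le_length_iff numeral_2_eq_2)
    have "length vs \<le> K" using vs K by (auto simp: rooted_cycles_def)
    moreover have "last (cycle_edges vs) = {last (v # xs), u}" "hd (cycle_edges vs) = {u, v}"
      using path_edges_snoc[of "u # v # xs" u] by (simp_all add: eq cycle_edges_def)
    ultimately have "((length xs, u, v), xs) \<in> ?I"
      using vs by (auto simp: eq rooted_cycles_def oriented_def paths_def)
    then show "vs \<in> ?c ` ?I"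
      unfolding eq by (intro image_eqI[of _ _ "((length xs, u, v), xs)"]) auto
  qed
  have w: "cycle_weight (u # v # xs) = x * path_weight (v # xs @ [u])" if "(u, v) \<in> oriented" for u v xs
    using that by (simp add: cycle_edges_def oriented_def weight_def)
  have "(\<Sum>vs\<in>rooted_cycles L. cycle_weight vs) \<le> (\<Sum>vs\<in>?c ` ?I. cycle_weight vs)"
    using fin sub by (intro sum_mono2 weights_nonneg) auto
  also have "\<dots> \<le> (\<Sum>i\<in>?I. cycle_weight (?c i))"
    using sum_image_le[OF fin, of cycle_weight ?c] weights_nonneg by (simp add: comp_def)
  also have "\<dots> = (\<Sum>(k, u, v)\<in>{..<K} \<times> oriented. \<Sum>xs\<in>paths u k u v. cycle_weight (u # v # xs))"
    using sum.Sigma[of "{..<K} \<times> oriented" ?P "\<lambda>q xs. cycle_weight (?c (q, xs))"] finite_oriented finite_paths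
    by (simp add: case_prod_unfold)
  also have "\<dots> = (\<Sum>k<K. \<Sum>(u, v)\<in>oriented. x * path_sum u k u v)"
    unfolding sum.cartesian_product[symmetric]
    by (intro sum.cong refl) (auto simp: path_sum_def sum_distrib_left w simp del: list.map)
  also have "\<dots> \<le> (\<Sum>k<K. \<Sum>(u, v)\<in>oriented. x * \<alpha> k)"
  proof (intro sum_mono)
    fix k p assume "p \<in> oriented"
    then show "(case p of (u, v) \<Rightarrow> x * path_sum u k u v) \<le> (case p of (u, v) \<Rightarrow> x * \<alpha> k)"
      using path_sum_le[of "fst p" k "fst p" "snd p"] x
      by (auto simp: oriented_def intro!: mult_left_mono)
  qed
  also have "\<dots> = card oriented * (x * (\<Sum>k<K. \<alpha> k))"
    by (simp add: sum_distrib_left case_prod_unfold)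
  also have "\<dots> \<le> (2 * card V) * (x * (2 * y / ((1 - x) * (1 - card U * y))))"
    using card_oriented_le sum_alpha_le[OF assms(3)] x bounds_nonneg
    by (intro mult_mono) (auto intro!: mult_left_mono sum_nonneg mult_nonneg_nonneg simp flip: of_nat_mult)
  also have "\<dots> = 2 * \<kappa>" by (simp add: \<kappa>_def)
  finally show ?thesis .
qed

lemma cycle_weight_rotate: "cycle_weight (rotate i vs) = cycle_weight vs"
proof -
  have "prod_list (map weight (rotate1 es)) = prod_list (map weight es)" for es
    by (cases es) (auto simp: mult.commute)
  then have "prod_list (map weight (rotate i es)) = prod_list (map weight es)" for es
    by (induction i) auto
  then show ?thesis by (simp add: cycle_edges_rotate)
qed

definition mixed_cycles :: "nat set \<Rightarrow> 'a list set" where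
  "mixed_cycles L = {vs. length vs \<in> L \<and> distinct vs \<and> set vs \<subseteq> U
     \<and> (\<exists>e\<in>set (cycle_edges vs). e \<in> W) \<and> (\<exists>e\<in>set (cycle_edges vs). e \<notin> W)}"

lemma mixed_cycle_rotate:
  assumes "vs \<in> mixed_cycles L"
  obtains i where "i < length vs" "rotate i vs \<in> rooted_cycles L"
proof -
  obtain i where "i < length vs" "hd (rotate i (cycle_edges vs)) \<in> W" "last (rotate i (cycle_edges vs)) \<notin> W"
    using rotate_to_boundary[of "cycle_edges vs" "\<lambda>e. e \<in> W"] assms by (auto simp: mixed_cycles_def)
  then show ?thesis
    using assms by (intro that[of i]) (auto simp: mixed_cycles_def rooted_cycles_def cycle_edges_rotate)
qed

lemma finite_rooted_cycles: "finite L \<Longrightarrow> finite (rooted_cycles L)"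
proof (rule finite_subset)
  show "rooted_cycles L \<subseteq> (\<Union>m\<in>L. {vs. set vs \<subseteq> U \<and> length vs = m})"
    by (auto simp: rooted_cycles_def)
qed (auto intro: finite_lists_length_eq finite_U)

lemma mixed_cycles_sum:
  fixes M :: nat
  assumes "finite L" "\<And>m. m \<in> L \<Longrightarrow> 2 \<le> m \<and> m \<le> M" "\<kappa> \<le> 1 / 2"
  shows "(\<Sum>vs\<in>mixed_cycles L. cycle_weight vs) \<le> M * (2 * \<kappa>)"
proof -
  let ?I = "{1..M} \<times> rooted_cycles L"
  have fin: "finite ?I" by (intro finite_cartesian_product finite_rooted_cycles assms(1)) simp
  have sub: "mixed_cycles L \<subseteq> (\<lambda>(j, vs). rotate j vs) ` ?I"
  proof
    fix vs assume vs: "vs \<in> mixed_cycles L"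
    then obtain i where i: "i < length vs" "rotate i vs \<in> rooted_cycles L" by (rule mixed_cycle_rotate)
    have "rotate (length vs - i) (rotate i vs) = vs"
      using i by (simp add: rotate_rotate)
    moreover have "length vs \<le> M" using vs assms(2) by (auto simp: mixed_cycles_def)
    ultimately show "vs \<in> (\<lambda>(j, vs). rotate j vs) ` ?I"
      using i by (intro image_eqI[of _ _ "(length vs - i, rotate i vs)"]) auto
  qed
  have "(\<Sum>vs\<in>mixed_cycles L. cycle_weight vs) \<le> (\<Sum>vs\<in>(\<lambda>(j, vs). rotate j vs) ` ?I. cycle_weight vs)"
    using fin sub by (intro sum_mono2 weights_nonneg) auto
  also have "\<dots> \<le> (\<Sum>(j, vs)\<in>?I. cycle_weight (rotate j vs))"
    using sum_image_le[OF fin, of cycle_weight "\<lambda>(j, vs). rotate j vs"] weights_nonneg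
    by (simp add: case_prod_unfold comp_def)
  also have "\<dots> = M * (\<Sum>vs\<in>rooted_cycles L. cycle_weight vs)"
    by (simp add: cycle_weight_rotate flip: sum.cartesian_product)
  also have "\<dots> \<le> M * (2 * \<kappa>)"
    using assms by (intro mult_left_mono rooted_cycles_sum) auto
  finally show ?thesis .
qed

lemma successor_unique:
  assumes "{v, a} \<in> W" "{v, b} \<in> W" "{v, c} \<in> W" "b \<noteq> a" "c \<noteq> a"
  shows "b = c"
proof (rule ccontr)
  assume "b \<noteq> c"
  then have "card {a, b, c} = 3" using assms by auto
  moreover have "card {a, b, c} \<le> card {u. {v, u} \<in> W}"
    using assms by (intro card_mono finite_neighbours) auto
  ultimately show False using degree[of v] by linarith
qed

text \<open>A cycle inside \<open>W\<close> is determined by its first two vertices.\<close>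

lemma
  shows finite_inner_cycles: "finite {vs. 3 \<le> length vs \<and> distinct vs \<and> set (cycle_edges vs) \<subseteq> W}"
    and card_inner_cycles_le: "card {vs. 3 \<le> length vs \<and> distinct vs \<and> set (cycle_edges vs) \<subseteq> W} \<le> 2 * card V"
proof -
  let ?C = "{vs. 3 \<le> length vs \<and> distinct vs \<and> set (cycle_edges vs) \<subseteq> W}"
  have edge: "{vs ! i, vs ! (Suc i mod length vs)} \<in> W" if "vs \<in> ?C" "i < length vs" for vs i
  proof -
    have "cycle_edges vs ! i \<in> set (cycle_edges vs)" using that by (intro nth_mem) auto
    then show ?thesis using that by (auto simp: nth_cycle_edges)
  qed
  have agree: "us ! i = vs ! i" 
    if us: "us \<in> ?C" and vs: "vs \<in> ?C" and start: "us ! 0 = vs ! 0" "us ! 1 = vs ! 1"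
      and i: "i < length us" "i < length vs" for us vs i
    using i
  proof (induction i rule: less_induct)
    case (less i)
    show ?case
    proof (cases "i < 2")
      case True
      then have "i = 0 \<or> i = 1" by linarith
      then show ?thesis using start by auto
    next
      case False
      define j where "j = i - 2"
      have j: "i = Suc (Suc j)" using False by (simp add: j_def)
      have eq: "us ! j = vs ! j" "us ! Suc j = vs ! Suc j" using less j by auto
      have "{us ! Suc j, us ! j} \<in> W" "{us ! Suc j, us ! Suc (Suc j)} \<in> W"
        using edge[OF us, of j] edge[OF us, of "Suc j"] less j by (auto simp: insert_commute)
      moreover have "{vs ! Suc j, vs ! Suc (Suc j)} \<in> W"
        using edge[OF vs, of "Suc j"] less j by auto
      moreover have "us ! Suc (Suc j) \<noteq> us ! j" "vs ! Suc (Suc j) \<noteq> vs ! j"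
        using us vs less.prems j by (auto simp: nth_eq_iff_index_eq)
      ultimately show ?thesis using successor_unique[of "us ! Suc j" "us ! j"] eq j by auto
    qed
  qed
  \<comment> \<open>If \<open>us\<close> were shorter, its last vertex would be followed in
    \<open>W\<close> by \<open>us ! 0\<close> along \<open>us\<close> and by \<open>vs ! m\<close>
    along \<open>vs\<close>. Uniqueness makes these equal, so \<open>vs\<close> would repeat its
    first vertex.\<close>
  have len: "\<not> length us < length vs"
    if us: "us \<in> ?C" and vs: "vs \<in> ?C" and start: "us ! 0 = vs ! 0" "us ! 1 = vs ! 1" for us vs
  proof
    assume l: "length us < length vs"
    define m where "m = length us"
    have m3: "3 \<le> m" using us by (auto simp: m_def)
    define j where "j = m - 2"
    have j: "m = Suc (Suc j)" using m3 by (simp add: j_def)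
    have eq: "us ! j = vs ! j" "us ! Suc j = vs ! Suc j"
      using agree[OF us vs start] l j by (auto simp: m_def)
    have "{us ! Suc j, us ! j} \<in> W" "{us ! Suc j, us ! 0} \<in> W"
      using edge[OF us, of j] edge[OF us, of "Suc j"] j by (auto simp: m_def insert_commute)
    moreover have "{vs ! Suc j, vs ! m} \<in> W"
      using edge[OF vs, of "Suc j"] l j by (auto simp: m_def)
    moreover have "us ! 0 \<noteq> us ! j" "vs ! m \<noteq> vs ! j"
      using us vs l j m3 nth_eq_iff_index_eq[of us 0 j] nth_eq_iff_index_eq[of vs m j]
      unfolding m_def by auto
    ultimately have "us ! 0 = vs ! m"
      using successor_unique[of "us ! Suc j" "us ! j"] eq by auto
    then have "vs ! 0 = vs ! m" using start by simp
    then show False using vs l m3 nth_eq_iff_index_eq[of vs 0 m] length_0_conv[of vs] unfolding m_def by force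
  qed
  have inj: "inj_on (\<lambda>vs. (vs ! 0, vs ! 1)) ?C"
  proof (rule inj_onI)
    fix us vs assume us: "us \<in> ?C" and vs: "vs \<in> ?C" and "(us ! 0, us ! 1) = (vs ! 0, vs ! 1)"
    then have start: "us ! 0 = vs ! 0" "us ! 1 = vs ! 1" by auto
    then have "length us = length vs" using len[OF us vs] len[OF vs us] by auto
    then show "us = vs" using agree[OF us vs start] by (auto intro: nth_equalityI)
  qed
  have sub: "(\<lambda>vs. (vs ! 0, vs ! 1)) ` ?C \<subseteq> oriented"
  proof
    fix q assume "q \<in> (\<lambda>vs. (vs ! 0, vs ! 1)) ` ?C"
    then obtain vs where vs: "vs \<in> ?C" "q = (vs ! 0, vs ! 1)" by auto
    then have "Suc 0 mod length vs = 1" by auto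
    then show "q \<in> oriented" using edge[OF vs(1), of 0] vs by (cases "vs = []") (auto simp: oriented_def)
  qed
  show "finite ?C" by (rule finite_imageD[OF finite_subset[OF sub finite_oriented] inj])
  have "card ?C \<le> card oriented" by (rule card_inj_on_le[OF inj sub finite_oriented])
  then show "card ?C \<le> 2 * card V" using card_oriented_le by linarith
qed

end

section \<open>Cycles in the critical random graph\<close>

lemma potential_edges_finite: "finite (potential_edges n)"
  by (rule finite_subset[of _ "Pow {..<n}"]) (auto simp: potential_edges_def)

lemma prod_list_scale:
  fixes q :: real
  shows "prod_list (map (\<lambda>e. if e \<in> W then q * d else p * d) es)
    = d ^ length es * prod_list (map (\<lambda>e. if e \<in> W then q else p) es)"
  by (induction es) auto

lemma one_minus_exp_ge:
  fixes t :: real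
  assumes "0 \<le> t" "t \<le> 1"
  shows "t / 2 \<le> 1 - exp (- t)"
proof -
  have "1 + t \<le> exp t" by (rule exp_ge_add_one_self)
  then have "exp (- t) \<le> 1 / (1 + t)" using assms by (simp add: exp_minus field_simps)
  also have "\<dots> \<le> 1 - t / 2" 
  proof -
    have "t * t \<le> 1 * t" using assms by (intro mult_right_mono) auto
    then show ?thesis using assms by (simp add: field_simps)
  qed
  finally show ?thesis by simp
qed

text \<open>The last three assumptions hold for all large \<open>n\<close>. \<open>aN\<close> keeps
  medium lengths above 3 and lets a window of width \<open>a / 4 * N\<close> contain at most
  \<open>a * N / 2\<close> integers; \<open>bN\<close> gives \<open>m * m \<le> n / 2\<close> for
  medium lengths \<open>m\<close>; \<open>N_large\<close> keeps the discount exponents at most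
  1.\<close>

locale critical_graph =
  fixes n :: nat and a b N :: real
  assumes a: "0 < a" and ab: "a < b" and N_eq: "N = real n powr (1 / 3)"
    and aN: "4 \<le> a * N" and bN: "2 * b\<^sup>2 \<le> N" and N_large: "4 * (1 + b) \<le> N"
begin

lemma N_ge: "4 \<le> N" "1 \<le> N" "0 < N" using N_large a ab by auto

lemma N_cube: "N ^ 3 = n"
  using N_ge N_eq by (cases "n = 0") (auto simp: powr_powr powr_realpow[symmetric] simp flip: powr_numeral)

lemma n_ge: "2 \<le> n" "0 < n" "2 \<le> real n"
proof -
  have "1 * 4 \<le> N ^ 2 * N" using N_ge by (intro mult_mono) (auto simp: one_le_power)
  then have "4 \<le> real n" by (simp add: N_cube[symmetric] power3_eq_cube power2_eq_square)
  then show "2 \<le> n" "0 < n" "2 \<le> real n" by auto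
qed

definition lens :: "nat set" where "lens = {m. a * N < real m \<and> real m < b * N}"

definition cyc :: "nat set \<Rightarrow> nat list set" where
  "cyc S = {vs. length vs \<in> S \<and> distinct vs \<and> set vs \<subseteq> {..<n}}"

definition cyc_event :: "nat set \<Rightarrow> (nat set \<Rightarrow> bool) \<Rightarrow> bool" where
  "cyc_event S \<omega> \<longleftrightarrow> (\<exists>vs\<in>cyc S. \<forall>e\<in>set (cycle_edges vs). \<omega> e)"

sublocale bernoulli_cube "potential_edges n" "1 / real n"
  using n_ge by unfold_locales (auto simp: potential_edges_finite)

lemma mono_cyc_event: "mono (cyc_event S)"
  by (auto simp: mono_def cyc_event_def le_fun_def)

lemma lens_bounds:
  assumes "m \<in> lens"
  shows "3 \<le> m" "real m \<le> b * N" "a * N \<le> real m" "m \<le> nat \<lfloor>b * N\<rfloor>"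
  using assms aN by (auto simp: lens_def le_nat_floor)

lemma medium_cycle_eq: "has_medium_cycle a b n = cyc_event lens"
proof
  fix \<omega>
  show "has_medium_cycle a b n \<omega> = cyc_event lens \<omega>"
    unfolding has_medium_cycle_def is_cycle_iff cyc_event_def cyc_def N_eq[symmetric]
    using lens_bounds(1) by (auto simp: lens_def)
qed

lemma lens_subset: "lens \<subseteq> {1..nat \<lfloor>b * N\<rfloor>}"
  using lens_bounds by force

lemma finite_lens: "finite lens"
  using lens_subset by (rule finite_subset) simp

lemma floor_bN: "real (nat \<lfloor>b * N\<rfloor>) \<le> b * N"
  using a ab N_ge by (intro of_nat_floor) simp

lemma card_lens_le: "card lens \<le> b * N"
proof -
  have "card lens \<le> nat \<lfloor>b * N\<rfloor>" using card_mono[OF _ lens_subset] by simp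
  then show ?thesis using floor_bN by linarith
qed

lemma finite_cyc: "finite S \<Longrightarrow> finite (cyc S)"
proof (rule finite_subset)
  show "cyc S \<subseteq> (\<Union>m\<in>S. {vs. set vs \<subseteq> {..<n} \<and> length vs = m})"
    by (auto simp: cyc_def)
qed (auto intro: finite_lists_length_eq)

lemma cycle_edges_potential:
  assumes "vs \<in> cyc S" "\<And>m. m \<in> S \<Longrightarrow> 3 \<le> m"
  shows "set (cycle_edges vs) \<subseteq> potential_edges n"
  using assms cycle_edges_subset[of _ vs] card_cycle_edge[of vs]
  by (fastforce simp: cyc_def potential_edges_def)

lemma card_cycle_edges:
  assumes "vs \<in> cyc S" "\<And>m. m \<in> S \<Longrightarrow> 3 \<le> m"
  shows "card (set (cycle_edges vs)) = length vs"
  using assms distinct_cycle_edges[of vs] distinct_card[of "cycle_edges vs"] by (auto simp: cyc_def)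

lemma prod_cycle_edges:
  assumes "vs \<in> cyc S" "\<And>m. m \<in> S \<Longrightarrow> 3 \<le> m"
  shows "(\<Prod>e\<in>set (cycle_edges vs). g e) = prod_list (map g (cycle_edges vs))"
  using assms distinct_cycle_edges[of vs] by (simp add: cyc_def prod.distinct_set_conv_list)

lemma sum_cyc_lengths:
  fixes g :: "nat \<Rightarrow> real"
  assumes S: "finite S"
  shows "(\<Sum>vs\<in>cyc S. g (length vs)) = (\<Sum>m\<in>S. card (cyc {m}) * g m)"
proof -
  have "(\<Sum>vs\<in>cyc S. g (length vs)) = (\<Sum>m\<in>S. \<Sum>vs\<in>{vs\<in>cyc S. length vs = m}. g (length vs))"
    using S finite_cyc by (subst sum.group) (auto simp: cyc_def)
  also have "\<dots> = (\<Sum>m\<in>S. \<Sum>vs\<in>cyc {m}. g m)"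
    by (intro sum.cong) (auto simp: cyc_def)
  finally show ?thesis by simp
qed

text \<open>At most \<open>n ^ m\<close> lists against a probability \<open>1 / n ^ m\<close> for
  each: at criticality every length contributes at most a constant.\<close>

lemma card_cyc_le: "card (cyc {m}) * (1 / real n) ^ m \<le> 1"
proof -
  have "card (cyc {m}) \<le> card {vs. set vs \<subseteq> {..<n} \<and> length vs = m}"
    by (intro card_mono finite_lists_length_eq) (auto simp: cyc_def)
  also have "\<dots> = n ^ m" by (simp add: card_lists_length_eq)
  finally have "real (card (cyc {m})) \<le> real n ^ m" by (metis of_nat_le_iff of_nat_power)
  then show ?thesis using n_ge by (simp add: power_divide)
qed

lemma sum_cyc_prob_le:
  assumes "finite S"
  shows "(\<Sum>vs\<in>cyc S. (1 / real n) ^ length vs) \<le> card S"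
proof -
  have "(\<Sum>vs\<in>cyc S. (1 / real n) ^ length vs) \<le> (\<Sum>m\<in>S. 1)"
    unfolding sum_cyc_lengths[OF assms] by (intro sum_mono card_cyc_le)
  then show ?thesis by simp
qed

lemma E_cycle:
  assumes "vs \<in> cyc S" "\<And>m. m \<in> S \<Longrightarrow> 3 \<le> m"
  shows "E (all_on (set (cycle_edges vs))) = (1 / real n) ^ length vs"
  using assms cycle_edges_potential[OF assms] p_range finite_A
  by (subst bexp_all_on) (auto simp: card_cycle_edges[OF assms])

lemma degree_two_cycle:
  fixes x y :: real
  assumes "cs \<in> cyc S" "0 \<le> x" "x < 1" "0 \<le> y" "n * y < 1"
  shows "degree_two_edges (set (cycle_edges cs)) (set cs) {..<n} x y"
proof
  show "u \<in> set cs" if "{u, v} \<in> set (cycle_edges cs)" for u v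
    using cycle_edges_subset[OF that] by auto
qed (use assms card_neighbours_cycle[of cs] in \<open>auto simp: cyc_def\<close>)

text \<open>With \<open>y = d / n\<close> and all \<open>n\<close> vertices allowed,
  \<open>card U * y\<close> is \<open>d\<close>; for \<open>d = 1\<close> the denominator would
  vanish. The numerator uses that \<open>cs\<close> has at most \<open>b * N\<close> vertices and
  that \<open>x < 1\<close>.\<close>

lemma kappa_le:
  fixes x d :: real
  assumes "cs \<in> cyc lens" "0 \<le> x" "x < 1" "0 < d" "d < 1"
  shows "2 * card (set cs) * x * (1 / n * d) / ((1 - x) * (1 - card {..<n} * (1 / n * d)))
    \<le> 2 * b * N / n / ((1 - x) * (1 - d))"
proof -
  have "card (set cs) = length cs" "length cs \<in> lens" using assms by (auto simp: cyc_def distinct_card)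
  then have "card (set cs) \<le> b * N" using lens_bounds by simp
  then have "card (set cs) * x * (1 / n * d) \<le> (b * N) * 1 * (1 / n * 1)"
    using assms n_ge by (intro mult_mono) (auto intro!: mult_nonneg_nonneg)
  then have "2 * card (set cs) * x * (1 / n * d) \<le> 2 * b * N / n" by simp
  moreover have "0 \<le> (1 - x) * (1 - d)" using assms by simp
  ultimately have "2 * card (set cs) * x * (1 / n * d) / ((1 - x) * (1 - d)) \<le> 2 * b * N / n / ((1 - x) * (1 - d))"
    by (rule divide_right_mono)
  moreover have "card {..<n} * (1 / n * d) = d" using n_ge by simp
  ultimately show ?thesis by simp
qed

text \<open>Discounting every edge by \<open>exp (- l / N)\<close> costs only a constant factor on medium cycles, and makes
  the weighted sums over unbounded lengths converge.\<close>

lemma scale_bound: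
  fixes l w u :: real
  assumes "length vs \<in> lens" "0 \<le> l" "0 \<le> w" "exp (- l / N) ^ length vs * w \<le> u"
  shows "w \<le> exp (l * b) * u"
proof -
  have "real (length vs) * (l / N) \<le> (b * N) * (l / N)"
    using lens_bounds(2)[OF assms(1)] assms(2) N_ge by (intro mult_right_mono) auto
  then have "real (length vs) * (l / N) \<le> l * b" using N_ge by (simp add: mult.commute)
  then have "exp (- (l * b)) \<le> exp (- l / N) ^ length vs"
    by (simp add: exp_of_nat_mult[symmetric])
  then have "exp (- (l * b)) * w \<le> u"
    using assms mult_right_mono by fastforce
  then have "exp (l * b) * (exp (- (l * b)) * w) \<le> exp (l * b) * u" by (intro mult_left_mono) auto
  then show ?thesis by (simp add: mult.assoc[symmetric] exp_add[symmetric])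
qed

section \<open>Upper bound given a witness\<close>

lemma one_witness_cycle:
  assumes "W \<in> one_witnesses (potential_edges n) (cyc_event lens)"
  obtains cs where "cs \<in> cyc lens" "W = set (cycle_edges cs)"
proof -
  have "(\<lambda>e. e \<in> W) \<in> configs (potential_edges n)"
    using one_witnessesD(1)[OF assms] by (auto simp: configs_def PiE_dflt_def)
  then have "cyc_event lens (\<lambda>e. e \<in> W)" using one_witnessesD(2)[OF assms] by auto
  then obtain cs where cs: "cs \<in> cyc lens" "set (cycle_edges cs) \<subseteq> W"
    by (auto simp: cyc_event_def)
  have "forces_true (potential_edges n) (cyc_event lens) (set (cycle_edges cs))"
    using cs(1) by (auto simp: forces_true_def cyc_event_def)
  \<comment> \<open>The cycle found inside \<open>W\<close> already forces the event, so minimality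
    leaves nothing else in \<open>W\<close>.\<close>
  then have "W = set (cycle_edges cs)" using one_witnessesD(3)[OF assms] cs(2) by blast
  then show ?thesis using cs that by blast
qed

text \<open>A medium cycle present after noise is of one of three kinds. Disjoint from
  \<open>W\<close>, it survives erasing \<open>W\<close>. Inside \<open>W\<close>, it is all of
  \<open>W\<close> by minimality, and the survival of \<open>W\<close> gives the exponential term.
  Otherwise it is mixed and has a rooted rotation, which gives the term with
  \<open>1 / (N * \<epsilon>)\<close>.\<close>

lemma witness_upper:
  fixes \<epsilon> :: real
  assumes W: "W \<in> one_witnesses (potential_edges n) (cyc_event lens)"
    and \<epsilon>: "0 < \<epsilon>" "\<epsilon> < 1" and small: "8 * b / (N * \<epsilon>) \<le> 1 / 2"
  shows "bexp (potential_edges n) (witness_law \<epsilon> W) (\<lambda>\<omega>. of_bool (cyc_event lens \<omega>))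
    \<le> E (\<lambda>\<omega>. of_bool (cyc_event lens \<omega>)) + (exp (- (\<epsilon> * N * a / 2)) + exp b * (16 * b / (N * \<epsilon>)))"
proof -
  obtain cs where cs: "cs \<in> cyc lens" "W = set (cycle_edges cs)"
    using one_witness_cycle[OF W] .
  \<comment> \<open>The probability that an edge of \<open>W\<close> is open after noise; since
    \<open>n\<close> is at least 2, it is at most \<open>1 - \<epsilon> / 2\<close>.\<close>
  define q where "q = 1 - \<epsilon> + \<epsilon> * (1 / real n)"
  define d where "d = exp (- 1 / N)"
  have "\<epsilon> * (1 / real n) \<le> \<epsilon> * (1 / 2)" using n_ge \<epsilon> by (intro mult_left_mono) (auto simp: field_simps)
  then have q: "0 \<le> q" "q < 1" "\<epsilon> / 2 \<le> 1 - q"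
    using \<epsilon> unfolding q_def by (simp, linarith, linarith)
  have d: "0 < d" "d < 1" using N_ge by (auto simp: d_def)
  have qd: "0 \<le> q * d" "q * d \<le> q" "q * d < 1" using q d by (auto simp: mult_le_cancel_left1 mult_left_le intro: le_less_trans[of _ q])
  interpret D: degree_two_edges W "set cs" "{..<n}" "q * d" "1 / n * d"
    unfolding cs(2) using cs(1) qd d n_ge by (intro degree_two_cycle[of _ lens]) auto
  have lawE: "witness_law \<epsilon> W e = (if e \<in> W then q else 1 / n)" for e by (simp add: witness_law_def q_def)
  have kappa: "D.\<kappa> \<le> 8 * b / (N * \<epsilon>)"
  proof -
    have "D.\<kappa> \<le> 2 * b * N / n / ((1 - q * d) * (1 - d))"
      unfolding D.\<kappa>_def using cs(1) qd d by (intro kappa_le) auto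
    \<comment> \<open>The noise makes the run factor \<open>1 - q * d\<close> at least
      \<open>\<epsilon> / 2\<close>, the discount makes the excursion factor \<open>1 - d\<close> at
      least \<open>1 / (2 * N)\<close>; with \<open>n = N ^ 3\<close> the order is
      \<open>1 / (N * \<epsilon>)\<close>.\<close>
    also have "\<dots> \<le> 2 * b * N / n / (\<epsilon> / 2 * (1 / (2 * N)))"
    proof (intro divide_left_mono mult_mono)
      show "1 / (2 * N) \<le> 1 - d" using one_minus_exp_ge[of "1 / N"] N_ge by (simp add: d_def)
    qed (use q qd d \<epsilon> N_ge a ab in \<open>auto intro!: mult_pos_pos\<close>)
    also have "\<dots> = 8 * b * N\<^sup>2 / (N ^ 3 * \<epsilon>)"
      using \<epsilon> N_ge by (simp add: N_cube[symmetric] field_simps power2_eq_square)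
    also have "\<dots> = 8 * b / (N * \<epsilon>)"
      using N_ge \<epsilon> by (simp add: power3_eq_cube power2_eq_square)
    finally show ?thesis .
  qed
  let ?R = "D.rooted_cycles lens"
  let ?bad = "\<lambda>\<omega>. all_on W \<omega> + (\<Sum>vs\<in>?R. all_on (set (cycle_edges vs)) \<omega>)"
  have R: "vs \<in> cyc lens" if "vs \<in> ?R" for vs
    using that by (auto simp: D.rooted_cycles_def cyc_def)
  have finR: "finite ?R" by (intro D.finite_rooted_cycles finite_lens)
  have law: "0 \<le> witness_law \<epsilon> W e" "witness_law \<epsilon> W e \<le> 1" for e
    using witness_law_range[of \<epsilon> W e] \<epsilon> by auto
  have "bexp (potential_edges n) (witness_law \<epsilon> W) (\<lambda>\<omega>. of_bool (cyc_event lens \<omega>))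
      \<le> E (\<lambda>\<omega>. of_bool (cyc_event lens \<omega>)) + bexp (potential_edges n) (witness_law \<epsilon> W) ?bad"
  proof (rule bexp_witness_law_le)
    fix \<omega> assume "cyc_event lens \<omega>"
    then obtain vs where vs: "vs \<in> cyc lens" "\<forall>e\<in>set (cycle_edges vs). \<omega> e"
      by (auto simp: cyc_event_def)
    consider "set (cycle_edges vs) \<inter> W = {}" | "set (cycle_edges vs) \<subseteq> W" | "vs \<in> D.mixed_cycles lens"
      using vs(1) by (auto simp: D.mixed_cycles_def cyc_def)
    then show "cyc_event lens (\<lambda>e. \<omega> e \<and> e \<notin> W) \<or> 1 \<le> ?bad \<omega>"
    proof cases
      case 1
      then show ?thesis using vs unfolding cyc_event_def by blast
    next
      case 2
      have "forces_true (potential_edges n) (cyc_event lens) (set (cycle_edges vs))"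
        using vs(1) by (auto simp: forces_true_def cyc_event_def)
      then have "W = set (cycle_edges vs)" using one_witnessesD(3)[OF W] 2 by blast
      then have "all_on W \<omega> = 1" using vs(2) by (auto simp: all_on_def)
      then show ?thesis by (auto simp: all_on_def intro!: sum_nonneg)
    next
      case 3
      then obtain i where i: "rotate i vs \<in> ?R" by (rule D.mixed_cycle_rotate)
      have "all_on (set (cycle_edges (rotate i vs))) \<omega> \<le> (\<Sum>vs\<in>?R. all_on (set (cycle_edges vs)) \<omega>)"
        using i finR by (intro member_le_sum) (auto simp: all_on_def)
      moreover have "all_on (set (cycle_edges (rotate i vs))) \<omega> = 1"
        using vs(2) by (auto simp: all_on_def cycle_edges_rotate)
      moreover have "0 \<le> all_on W \<omega>" by (simp add: all_on_def)
      ultimately show ?thesis by linarith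
    qed
  qed (use \<epsilon> mono_cyc_event in \<open>auto simp: all_on_def intro!: sum_nonneg add_nonneg_nonneg\<close>)
  also have "bexp (potential_edges n) (witness_law \<epsilon> W) ?bad
      = bexp (potential_edges n) (witness_law \<epsilon> W) (all_on W)
        + (\<Sum>vs\<in>?R. bexp (potential_edges n) (witness_law \<epsilon> W) (all_on (set (cycle_edges vs))))"
    by (simp add: bexp_add bexp_sum finite_A)
  also have "bexp (potential_edges n) (witness_law \<epsilon> W) (all_on W) = q ^ card W"
    using law one_witnessesD(1)[OF W] finite_A by (subst bexp_all_on) (auto simp: lawE)
  also have "q ^ card W \<le> exp (- (\<epsilon> * N * a / 2))"
  proof -
    have "q \<le> exp (- (\<epsilon> / 2))" using q(3) exp_ge_add_one_self[of "- (\<epsilon> / 2)"] by linarith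
    then have "q ^ card W \<le> exp (- (\<epsilon> / 2)) ^ card W" using q by (intro power_mono) auto
    also have "\<dots> = exp (- (card W * (\<epsilon> / 2)))" by (simp add: exp_of_nat_mult[symmetric])
    also have "\<dots> \<le> exp (- ((a * N) * (\<epsilon> / 2)))"
    proof -
      have "card W = length cs" "length cs \<in> lens"
        using card_cycle_edges[OF cs(1)] lens_bounds cs by (auto simp: cyc_def)
      then have "(a * N) * (\<epsilon> / 2) \<le> card W * (\<epsilon> / 2)"
        using lens_bounds(3) \<epsilon> by (intro mult_right_mono) auto
      then show ?thesis by simp
    qed
    finally show ?thesis by (simp add: mult_ac)
  qed
  also have "(\<Sum>vs\<in>?R. bexp (potential_edges n) (witness_law \<epsilon> W) (all_on (set (cycle_edges vs))))
      \<le> (\<Sum>vs\<in>?R. exp (1 * b) * D.cycle_weight vs)"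
  proof (intro sum_mono)
    fix vs assume vs: "vs \<in> ?R"
    have "bexp (potential_edges n) (witness_law \<epsilon> W) (all_on (set (cycle_edges vs)))
        = prod_list (map (witness_law \<epsilon> W) (cycle_edges vs))"
      using law cycle_edges_potential[OF R[OF vs]] lens_bounds finite_A
      by (subst bexp_all_on) (auto simp: prod_cycle_edges[OF R[OF vs]])
    also have "\<dots> \<le> exp (1 * b) * D.cycle_weight vs"
    proof (rule scale_bound)
      show "length vs \<in> lens" using vs by (auto simp: D.rooted_cycles_def)
      show "0 \<le> prod_list (map (witness_law \<epsilon> W) (cycle_edges vs))"
        using law by (auto intro!: prod_list_nonneg)
      have "D.cycle_weight vs = d ^ length vs * prod_list (map (witness_law \<epsilon> W) (cycle_edges vs))"
        using prod_list_scale[of W q d "1 / n" "cycle_edges vs"]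
        unfolding D.weight_def[abs_def] lawE[abs_def] by simp
      then show "exp (- 1 / N) ^ length vs * prod_list (map (witness_law \<epsilon> W) (cycle_edges vs))
          \<le> D.cycle_weight vs" by (simp add: d_def)
    qed simp
    finally show "bexp (potential_edges n) (witness_law \<epsilon> W) (all_on (set (cycle_edges vs)))
        \<le> exp (1 * b) * D.cycle_weight vs" .
  qed
  also have "\<dots> = exp b * (\<Sum>vs\<in>?R. D.cycle_weight vs)" by (simp add: sum_distrib_left)
  also have "\<dots> \<le> exp b * (2 * D.\<kappa>)"
    using kappa small lens_bounds(1) by (intro mult_left_mono D.rooted_cycles_sum finite_lens) force+
  also have "\<dots> \<le> exp b * (16 * b / (N * \<epsilon>))"
    using kappa by (intro mult_left_mono) auto
  finally show ?thesis by simp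
qed

text \<open>Every cycle is listed once per starting point and orientation, about \<open>N\<close> times; hence the
  normalisation.\<close>

definition X :: "(nat set \<Rightarrow> bool) \<Rightarrow> real" where
  "X \<omega> = (\<Sum>vs\<in>cyc lens. (1 / N) * all_on (set (cycle_edges vs)) \<omega>)"

section \<open>Moments of the number of medium cycles\<close>

lemma E_X: "E X = (1 / N) * (\<Sum>vs\<in>cyc lens. (1 / real n) ^ length vs)"
proof -
  have "E X = (\<Sum>vs\<in>cyc lens. (1 / N) * E (all_on (set (cycle_edges vs))))"
    unfolding X_def by (simp only: bexp_sum[OF finite_A] bexp_cmult)
  also have "\<dots> = (\<Sum>vs\<in>cyc lens. (1 / N) * (1 / real n) ^ length vs)"
    by (intro sum.cong refl arg_cong2[of _ _ _ _ "(*)"] E_cycle lens_bounds)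
  finally show ?thesis by (simp only: sum_distrib_left)
qed

text \<open>The number of lists is a falling factorial, at least \<open>(n - m) ^ m\<close>.
  Bernoulli's inequality gives \<open>(1 - m / n) ^ m \<ge> 1 - m * m / n\<close>, and
  \<open>m * m \<le> n / 2\<close> for medium lengths.\<close>

lemma card_cyc_ge:
  assumes "m \<in> lens"
  shows "1 / 2 \<le> card (cyc {m}) * (1 / real n) ^ m"
proof -
  have m: "real m \<le> b * N" using lens_bounds[OF assms] by auto
  then have "real m * real m \<le> (b * N) * (b * N)" by (intro mult_mono) auto
  also have "\<dots> \<le> N * N\<^sup>2 / 2"
    using mult_right_mono[OF bN, of "N\<^sup>2"] by (simp add: power2_eq_square mult_ac)
  also have "\<dots> = n / 2" using N_cube by (simp add: power3_eq_cube power2_eq_square)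
  finally have mm: "real m * real m \<le> n / 2" .
  moreover have "real m \<le> real m * real m"
    using lens_bounds(1)[OF assms] mult_left_mono[of 1 "real m" "real m"] by simp
  ultimately have mn: "m \<le> n" by linarith
  have "card (cyc {m}) = card {vs. length vs = m \<and> distinct vs \<and> set vs \<subseteq> {..<n}}"
    by (simp add: cyc_def)
  also have "\<dots> = \<Prod>{n - m + 1..n}"
    using mn by (subst card_lists_distinct_length_eq) auto
  also have "\<dots> \<ge> (\<Prod>i\<in>{n - m + 1..n}. n - m)"
    by (intro prod_mono) auto
  finally have "(n - m) ^ m \<le> card (cyc {m})" using mn by simp
  then have "real (n - m) ^ m \<le> card (cyc {m})" by (simp only: of_nat_le_iff flip: of_nat_power)
  then have "real (n - m) ^ m * (1 / real n) ^ m \<le> card (cyc {m}) * (1 / real n) ^ m"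
    by (intro mult_right_mono) auto
  moreover have "real (n - m) ^ m * (1 / real n) ^ m = (1 + - (m / n)) ^ m"
    using mn n_ge by (simp add: power_mult_distrib[symmetric] of_nat_diff diff_divide_distrib)
  moreover have "1 + real m * - (m / n) \<le> (1 + - (m / n)) ^ m"
    using mn n_ge by (intro Bernoulli_inequality) auto
  moreover have "real m * (m / n) \<le> 1 / 2" using mm n_ge by (simp add: field_simps)
  ultimately show ?thesis by simp
qed

lemma card_lens_ge: "(b - a) * N - 1 \<le> card lens"
proof -
  have "{nat \<lfloor>a * N\<rfloor> + 1..<nat \<lceil>b * N\<rceil>} \<subseteq> lens"
    using a N_ge by (auto simp: lens_def) linarith+
  from card_mono[OF finite_lens this] have "nat \<lceil>b * N\<rceil> - (nat \<lfloor>a * N\<rfloor> + 1) \<le> card lens"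
    by simp
  moreover have "0 \<le> a * N" "0 \<le> b * N" using a ab N_ge by auto
  ultimately show ?thesis by (simp add: left_diff_distrib) linarith
qed

lemma E_X_ge:
  assumes "4 \<le> (b - a) * N"
  shows "(b - a) / 4 \<le> E X"
proof -
  define t where "t = (b - a) * N"
  have "4 \<le> t" using assms by (simp only: t_def)
  then have "t / 4 \<le> (t - 1) / 2" by (simp add: field_simps)
  then have "(b - a) * N / 4 \<le> ((b - a) * N - 1) / 2" by (simp only: t_def)
  also have "\<dots> \<le> card lens / 2" using card_lens_ge by simp
  also have "\<dots> = (\<Sum>m\<in>lens. 1 / 2)" by simp
  also have "\<dots> \<le> (\<Sum>m\<in>lens. card (cyc {m}) * (1 / real n) ^ m)"
    by (intro sum_mono card_cyc_ge)
  also have "\<dots> = (\<Sum>vs\<in>cyc lens. (1 / real n) ^ length vs)"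
    by (rule sum_cyc_lengths[OF finite_lens, symmetric])
  also have "\<dots> = N * E X" unfolding E_X using N_ge by simp
  finally have "N * ((b - a) / 4) \<le> N * E X" by (simp only: mult.commute[of N] times_divide_eq_left)
  then show ?thesis using N_ge(3) by (rule mult_left_le_imp_le)
qed

text \<open>Given that \<open>cs\<close> is present, the expected number of listed medium cycles is
  still of order \<open>N\<close>. The constant collects 1 from cycles edge-disjoint from
  \<open>cs\<close>, 2 from those inside it (at most two per starting vertex), and the exponential,
  the price of the discount, from the mixed ones.\<close>

lemma overlap_sum_le:
  assumes cs: "cs \<in> cyc lens"
  shows "(\<Sum>vs\<in>cyc lens. \<Prod>e\<in>set (cycle_edges vs). if e \<in> set (cycle_edges cs) then 1 else 1 / real n)
    \<le> (b * (3 + exp (4 * (1 + b) * b))) * N"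
proof -
  define W where "W = set (cycle_edges cs)"
  \<comment> \<open>There is no noise here, so only the discount keeps \<open>x\<close> below 1, and
    \<open>\<kappa>\<close> is at most \<open>8 * b / l\<^sup>2\<close>; this \<open>l\<close>
    brings it down to 1/2.\<close>
  define l where "l = 4 * (1 + b)"
  define d where "d = exp (- l / N)"
  define g where "g = (\<lambda>vs. prod_list (map (\<lambda>e. if e \<in> W then 1 else 1 / real n) (cycle_edges vs)))"
  have l: "0 < l" "l / N \<le> 1" using a ab N_large N_ge by (auto simp: l_def)
  have d: "0 < d" "d < 1" using N_ge l by (auto simp: d_def)
  interpret D: degree_two_edges W "set cs" "{..<n}" "1 * d" "1 / n * d"
    unfolding W_def by (rule degree_two_cycle[OF cs]) (use d n_ge in auto)
  have g_nonneg: "0 \<le> g vs" for vs unfolding g_def by (intro prod_list_nonneg) auto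
  have eq: "(\<Prod>e\<in>set (cycle_edges vs). if e \<in> set (cycle_edges cs) then 1 else 1 / real n) = g vs"
    if "vs \<in> cyc lens" for vs
    unfolding g_def W_def using lens_bounds by (intro prod_cycle_edges[OF that])
  have kappa: "D.\<kappa> \<le> 1 / 2"
  proof -
    have "D.\<kappa> \<le> 2 * b * N / n / ((1 - 1 * d) * (1 - d))"
      unfolding D.\<kappa>_def using cs d by (intro kappa_le) auto
    also have "\<dots> \<le> 2 * b * N / n / ((l / N) / 2 * ((l / N) / 2))"
    proof -
      have "(l / N) / 2 \<le> 1 - d" using one_minus_exp_ge[of "l / N"] l N_ge by (simp add: d_def)
      then show ?thesis using l N_ge a ab d
        by (intro divide_left_mono mult_mono) (auto intro!: mult_pos_pos)
    qed
    also have "\<dots> = 8 * b / l\<^sup>2"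
      using l N_ge by (simp add: N_cube[symmetric] field_simps power2_eq_square power3_eq_cube)
    also have "\<dots> \<le> 1 / 2"
    proof -
      have "16 * b \<le> l\<^sup>2" using a ab by (simp add: l_def power2_eq_square algebra_simps)
      then show ?thesis using l by (simp add: field_simps)
    qed
    finally show ?thesis .
  qed
  let ?dis = "{vs \<in> cyc lens. set (cycle_edges vs) \<inter> W = {}}"
  let ?inn = "{vs \<in> cyc lens. set (cycle_edges vs) \<subseteq> W}"
  let ?mix = "D.mixed_cycles lens"
  have fin: "finite (cyc lens)" by (intro finite_cyc finite_lens)
  have mix: "?mix \<subseteq> cyc lens" by (auto simp: D.mixed_cycles_def cyc_def)
  have finmix: "finite ?mix" using fin mix by (rule finite_subset[rotated])
  have cover: "cyc lens = ?dis \<union> ?inn \<union> ?mix"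
    by (auto simp: D.mixed_cycles_def cyc_def)
  have "(\<Sum>vs\<in>cyc lens. g vs) \<le> (\<Sum>vs\<in>?dis. g vs) + (\<Sum>vs\<in>?inn. g vs) + (\<Sum>vs\<in>?mix. g vs)"
  proof -
    have "sum g (?dis \<union> ?inn \<union> ?mix) \<le> sum g (?dis \<union> ?inn) + sum g ?mix"
      using fin finmix g_nonneg by (subst sum.union_inter[symmetric]) (auto intro: sum_nonneg)
    moreover have "sum g (?dis \<union> ?inn) \<le> sum g ?dis + sum g ?inn"
      using fin g_nonneg by (subst sum.union_inter[symmetric]) (auto intro: sum_nonneg)
    ultimately show ?thesis using cover by simp
  qed
  also have "(\<Sum>vs\<in>?dis. g vs) \<le> b * N"
  proof -
    have "(\<Sum>vs\<in>?dis. g vs) = (\<Sum>vs\<in>?dis. (1 / real n) ^ length vs)"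
    proof (intro sum.cong refl)
      fix vs assume "vs \<in> ?dis"
      then have "map (\<lambda>e. if e \<in> W then 1 else 1 / real n) (cycle_edges vs)
          = map (\<lambda>e. 1 / real n) (cycle_edges vs)" by auto
      then show "g vs = (1 / real n) ^ length vs"
        unfolding g_def by (simp only: map_replicate_const prod_list_replicate length_cycle_edges)
    qed
    also have "\<dots> \<le> (\<Sum>vs\<in>cyc lens. (1 / real n) ^ length vs)"
      using fin by (intro sum_mono2) auto
    also have "\<dots> \<le> card lens" by (rule sum_cyc_prob_le[OF finite_lens])
    also have "\<dots> \<le> b * N" by (rule card_lens_le)
    finally show ?thesis .
  qed
  also have "(\<Sum>vs\<in>?inn. g vs) \<le> 2 * (b * N)"
  proof -
    have "map (\<lambda>e. if e \<in> W then 1 else 1 / real n) (cycle_edges vs) = map (\<lambda>e. 1) (cycle_edges vs)"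
      if "vs \<in> ?inn" for vs using that by auto
    then have "(\<Sum>vs\<in>?inn. g vs) = (\<Sum>vs\<in>?inn. 1)"
      unfolding g_def by (intro sum.cong refl) (simp only: map_replicate_const prod_list_replicate power_one)
    also have "\<dots> = card ?inn" by simp
    also have "\<dots> \<le> card {vs. 3 \<le> length vs \<and> distinct vs \<and> set (cycle_edges vs) \<subseteq> W}"
      using lens_bounds(1) by (intro of_nat_mono card_mono D.finite_inner_cycles) (auto simp: cyc_def)
    also have "\<dots> \<le> real (2 * card (set cs))" by (intro of_nat_mono D.card_inner_cycles_le)
    also have "\<dots> = 2 * real (length cs)" using cs by (auto simp: cyc_def distinct_card)
    also have "\<dots> \<le> 2 * (b * N)" using cs lens_bounds(2) by (auto simp: cyc_def)
    finally show ?thesis .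
  qed
  also have "(\<Sum>vs\<in>?mix. g vs) \<le> exp (l * b) * (b * N)"
  proof -
    have "(\<Sum>vs\<in>?mix. g vs) \<le> (\<Sum>vs\<in>?mix. exp (l * b) * D.cycle_weight vs)"
    proof (intro sum_mono scale_bound g_nonneg)
      fix vs assume "vs \<in> ?mix"
      then show "length vs \<in> lens" by (auto simp: D.mixed_cycles_def)
      have "D.cycle_weight vs = d ^ length vs * g vs"
        using prod_list_scale[of W 1 d "1 / n" "cycle_edges vs"]
        unfolding D.weight_def[abs_def] g_def by simp
      then show "exp (- l / N) ^ length vs * g vs \<le> D.cycle_weight vs" by (simp add: d_def)
    qed (use l in auto)
    also have "\<dots> = exp (l * b) * (\<Sum>vs\<in>?mix. D.cycle_weight vs)" by (simp add: sum_distrib_left)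
    also have "\<dots> \<le> exp (l * b) * (nat \<lfloor>b * N\<rfloor> * (2 * D.\<kappa>))"
      using kappa lens_bounds by (intro mult_left_mono D.mixed_cycles_sum finite_lens) force+
    also have "\<dots> \<le> exp (l * b) * (b * N * 1)"
    proof (intro mult_left_mono mult_mono)
      show "0 \<le> 2 * D.\<kappa>" unfolding D.\<kappa>_def using d n_ge by (auto intro!: divide_nonneg_nonneg mult_nonneg_nonneg)
    qed (use kappa floor_bN a ab N_ge in auto)
    finally show ?thesis by simp
  qed
  finally have "(\<Sum>vs\<in>cyc lens. g vs) \<le> b * N + 2 * (b * N) + exp (l * b) * (b * N)" by simp
  then show ?thesis by (simp add: eq l_def algebra_simps)
qed

text \<open>Conditioning on the first cycle of each pair turns the double sum into a first moment
  times an overlap sum: two factors of order \<open>N\<close>, cancelled by the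
  normalisation.\<close>

lemma second_moment: "E (\<lambda>\<omega>. (X \<omega>)\<^sup>2) \<le> b\<^sup>2 * (3 + exp (4 * (1 + b) * b))"
proof -
  let ?e = "\<lambda>vs. set (cycle_edges vs)"
  let ?C = "(b * (3 + exp (4 * (1 + b) * b))) * N"
  have C: "0 \<le> ?C" using a ab N_ge by simp
  have "E (\<lambda>\<omega>. (X \<omega>)\<^sup>2)
      = E (\<lambda>\<omega>. \<Sum>cs\<in>cyc lens. \<Sum>vs\<in>cyc lens. (1 / N)\<^sup>2 * (all_on (?e cs) \<omega> * all_on (?e vs) \<omega>))"
    unfolding X_def power2_eq_square sum_product by (simp add: mult_ac)
  also have "\<dots> = (\<Sum>cs\<in>cyc lens. \<Sum>vs\<in>cyc lens. (1 / N)\<^sup>2 * E (\<lambda>\<omega>. all_on (?e cs) \<omega> * all_on (?e vs) \<omega>))"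
    by (simp only: bexp_sum[OF finite_A] bexp_cmult)
  also have "\<dots> = (\<Sum>cs\<in>cyc lens. \<Sum>vs\<in>cyc lens. (1 / N)\<^sup>2 *
      ((1 / n) ^ length cs * (\<Prod>e\<in>?e vs. if e \<in> ?e cs then 1 else 1 / real n)))"
  proof (intro sum.cong refl arg_cong2[of _ _ _ _ "(*)"])
    fix cs vs assume cs: "cs \<in> cyc lens" and vs: "vs \<in> cyc lens"
    have pot: "?e cs \<subseteq> potential_edges n" "?e vs \<subseteq> potential_edges n"
      using cs vs lens_bounds(1) cycle_edges_potential by blast+
    have "E (\<lambda>\<omega>. all_on (?e cs) \<omega> * all_on (?e vs) \<omega>)
        = (\<Prod>e\<in>?e cs. 1 / real n) * bexp (potential_edges n) (\<lambda>e. if e \<in> ?e cs then 1 else 1 / real n) (all_on (?e vs))"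
      using p_range by (intro bexp_all_on_mult finite_A pot) auto
    also have "bexp (potential_edges n) (\<lambda>e. if e \<in> ?e cs then 1 else 1 / real n) (all_on (?e vs))
        = (\<Prod>e\<in>?e vs. if e \<in> ?e cs then 1 else 1 / real n)"
      using p_range by (intro bexp_all_on finite_A pot) auto
    also have "(\<Prod>e\<in>?e cs. 1 / real n) = (1 / n) ^ length cs"
      using card_cycle_edges[OF cs] lens_bounds(1) by simp
    finally show "E (\<lambda>\<omega>. all_on (?e cs) \<omega> * all_on (?e vs) \<omega>)
        = (1 / n) ^ length cs * (\<Prod>e\<in>?e vs. if e \<in> ?e cs then 1 else 1 / real n)" .
  qed
  also have "\<dots> = (\<Sum>cs\<in>cyc lens. (1 / N)\<^sup>2 * (1 / n) ^ length cs *
      (\<Sum>vs\<in>cyc lens. \<Prod>e\<in>?e vs. if e \<in> ?e cs then 1 else 1 / real n))"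
    by (simp add: sum_distrib_left mult.assoc)
  also have "\<dots> \<le> (\<Sum>cs\<in>cyc lens. (1 / N)\<^sup>2 * (1 / n) ^ length cs * ?C)"
    by (intro sum_mono mult_left_mono overlap_sum_le) auto
  also have "\<dots> = (1 / N)\<^sup>2 * ?C * (\<Sum>cs\<in>cyc lens. (1 / n) ^ length cs)"
    unfolding sum_distrib_left by (intro sum.cong refl) (simp only: mult_ac)
  also have "\<dots> \<le> (1 / N)\<^sup>2 * ?C * (b * N)"
    using C sum_cyc_prob_le[OF finite_lens] card_lens_le by (intro mult_left_mono) auto
  also have "\<dots> = b\<^sup>2 * (3 + exp (4 * (1 + b) * b))"
    using N_ge by (simp add: power2_eq_square)
  finally show ?thesis .
qed

text \<open>Each edge escapes resampling with probability
  \<open>1 - \<epsilon> \<ge> exp (- 2 * \<epsilon>)\<close>, so with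
  \<open>\<epsilon> * N \<le> K\<close> all of the at most \<open>b * N\<close> edges survive with
  probability at least \<open>exp (- 2 * K * b)\<close>. The error bounds the chance
  \<open>b * N / n\<close> that an unconditioned graph uses an edge of the cycle.\<close>

lemma witness_lower:
  fixes \<epsilon> K :: real
  assumes cs: "cs \<in> cyc lens" and \<epsilon>: "0 < \<epsilon>" "\<epsilon> \<le> 1 / 2" "\<epsilon> * N \<le> K"
  defines "P \<equiv> E (\<lambda>\<omega>. of_bool (cyc_event lens \<omega>))"
  shows "P + exp (- 2 * K * b) * (1 - P) - b / N\<^sup>2
    \<le> bexp (potential_edges n) (witness_law \<epsilon> (set (cycle_edges cs))) (\<lambda>\<omega>. of_bool (cyc_event lens \<omega>))"
proof -
  let ?W = "set (cycle_edges cs)"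
  have card: "card ?W = length cs" "length cs \<in> lens"
    using cs card_cycle_edges[OF cs] lens_bounds(1) by (auto simp: cyc_def)
  have "P \<le> E (\<lambda>_. 1)" unfolding P_def by (intro bexp_mono finite_A) auto
  then have P1: "P \<le> 1" by simp
  have "P + (1 - \<epsilon>) ^ card ?W * (1 - P) - card ?W * (1 / n)
      \<le> bexp (potential_edges n) (witness_law \<epsilon> ?W) (\<lambda>\<omega>. of_bool (cyc_event lens \<omega>))"
    unfolding P_def using \<epsilon> cs lens_bounds(1)
    by (intro bexp_witness_law_ge mono_cyc_event cycle_edges_potential[of _ lens]) (auto simp: cyc_event_def)
  moreover have "exp (- 2 * K * b) \<le> (1 - \<epsilon>) ^ card ?W"
  proof -
    have "exp (- 2 * \<epsilon>) \<le> 1 - \<epsilon>" using one_minus_exp_ge[of "2 * \<epsilon>"] \<epsilon> 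
      using ln_one_minus_pos_lower_bound[of \<epsilon>] by (simp add: exp_le_cancel_iff)
    then have "exp (- 2 * \<epsilon>) ^ card ?W \<le> (1 - \<epsilon>) ^ card ?W" by (intro power_mono) auto
    moreover have "exp (- 2 * \<epsilon>) ^ card ?W = exp (- 2 * (\<epsilon> * card ?W))"
      by (simp add: exp_of_nat_mult[symmetric] mult_ac)
    moreover have "\<epsilon> * card ?W \<le> K * b"
    proof -
      have "\<epsilon> * card ?W \<le> \<epsilon> * (b * N)" using card lens_bounds(2) \<epsilon> by (intro mult_left_mono) auto
      also have "\<dots> = (\<epsilon> * N) * b" by simp
      also have "\<dots> \<le> K * b" using \<epsilon> a ab by (intro mult_right_mono) auto
      finally show ?thesis .
    qed
    moreover have "exp (- 2 * K * b) \<le> exp (- 2 * (\<epsilon> * card ?W))" using calculation(3) by simp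
    ultimately show ?thesis by linarith
  qed
  then have "exp (- 2 * K * b) * (1 - P) \<le> (1 - \<epsilon>) ^ card ?W * (1 - P)"
    using P1 by (intro mult_right_mono) auto
  moreover have "card ?W * (1 / n) \<le> b / N\<^sup>2"
  proof -
    have "card ?W * (1 / n) \<le> (b * N) * (1 / n)" using card lens_bounds(2) by (intro mult_right_mono) auto
    also have "\<dots> = b / N\<^sup>2" using N_ge by (simp add: N_cube[symmetric] power2_eq_square power3_eq_cube)
    finally show ?thesis .
  qed
  ultimately show ?thesis by linarith
qed

section \<open>Nondegeneracy\<close>

lemma prob_cycle_ge:
  assumes "4 \<le> (b - a) * N"
  shows "((b - a) / 4)\<^sup>2 / (b\<^sup>2 * (3 + exp (4 * (1 + b) * b))) \<le> E (\<lambda>\<omega>. of_bool (cyc_event lens \<omega>))"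
proof -
  \<comment> \<open>Second moment method: \<open>X\<close> vanishes off the event, so expanding the
    square of \<open>t\<close> times its indicator minus \<open>X\<close> gives a quadratic
    inequality for the probability; \<open>t = M / c\<close> yields
    \<open>c\<^sup>2 / M\<close>.\<close>
  define P M c t where "P = E (\<lambda>\<omega>. of_bool (cyc_event lens \<omega>))" 
    and "M = b\<^sup>2 * (3 + exp (4 * (1 + b) * b))" and "c = (b - a) / 4" and "t = M / c"
  have "0 < c" using ab by (simp add: c_def)
  moreover have "0 < M" using a ab by (auto simp: M_def add_pos_pos)
  ultimately have t: "0 < t" "t * c = M" by (auto simp: t_def)
  have "0 \<le> E (\<lambda>\<omega>. (t * of_bool (cyc_event lens \<omega>) - X \<omega>)\<^sup>2)"
    by (intro bexp_nonneg finite_A) auto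
  also have "\<dots> = E (\<lambda>\<omega>. t\<^sup>2 * of_bool (cyc_event lens \<omega>) - 2 * t * X \<omega> + (X \<omega>)\<^sup>2)"
  proof -
    have "X \<omega> = 0" if "\<not> cyc_event lens \<omega>" for \<omega>
      using that by (auto simp: X_def cyc_event_def all_on_def intro!: sum.neutral)
    then have "(t * of_bool (cyc_event lens \<omega>) - X \<omega>)\<^sup>2
        = t\<^sup>2 * of_bool (cyc_event lens \<omega>) - 2 * t * X \<omega> + (X \<omega>)\<^sup>2" for \<omega>
      by (cases "cyc_event lens \<omega>") (auto simp: power2_eq_square algebra_simps)
    then show ?thesis by simp
  qed
  also have "\<dots> = t\<^sup>2 * P - 2 * t * E X + E (\<lambda>\<omega>. (X \<omega>)\<^sup>2)"
    by (simp only: bexp_add[OF finite_A] bexp_diff[OF finite_A] bexp_cmult P_def)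
  also have "\<dots> \<le> t\<^sup>2 * P - 2 * t * c + M"
  proof -
    have "t * c \<le> t * E X" using t E_X_ge[OF assms] by (intro mult_left_mono) (auto simp: c_def)
    then show ?thesis using second_moment by (simp add: M_def)
  qed
  finally have "M \<le> t\<^sup>2 * P" using t by simp
  then have "M / t\<^sup>2 \<le> P" using t by (simp add: field_simps)
  moreover have "M / t\<^sup>2 = c\<^sup>2 / M" using \<open>0 < c\<close> \<open>0 < M\<close> by (simp add: t_def power2_eq_square field_simps)
  ultimately show ?thesis by (simp add: P_def M_def c_def)
qed

lemma rotations_in_cyc:
  assumes "vs \<in> cyc S"
  shows "(\<lambda>i. rotate i vs) ` {..<length vs} \<subseteq> cyc S" "inj_on (\<lambda>i. rotate i vs) {..<length vs}"
proof -
  show "(\<lambda>i. rotate i vs) ` {..<length vs} \<subseteq> cyc S" using assms by (auto simp: cyc_def)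
  show "inj_on (\<lambda>i. rotate i vs) {..<length vs}"
  proof (rule inj_onI)
    fix i j assume ij: "i \<in> {..<length vs}" "j \<in> {..<length vs}" "rotate i vs = rotate j vs"
    then have "vs \<noteq> []" by auto
    then have "vs ! i = vs ! j" using ij hd_rotate_conv_nth[of vs i] hd_rotate_conv_nth[of vs j] by simp
    then show "i = j" using ij assms by (auto simp: cyc_def nth_eq_iff_index_eq)
  qed
qed

text \<open>One cycle with length in \<open>S\<close> brings all its rotations, at least
  \<open>u\<close> lists, into the count. This gains the factor \<open>1 / u\<close> over the plain
  first moment bound \<open>card S\<close>, which is too large on its own.\<close>

lemma prob_cyc_event_le:
  fixes u :: real
  assumes "finite S" "0 < u" "\<And>m. m \<in> S \<Longrightarrow> u \<le> real m" "\<And>m. m \<in> S \<Longrightarrow> 3 \<le> m"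
  shows "E (\<lambda>\<omega>. of_bool (cyc_event S \<omega>)) \<le> card S / u"
proof -
  have "u * E (\<lambda>\<omega>. of_bool (cyc_event S \<omega>)) = E (\<lambda>\<omega>. u * of_bool (cyc_event S \<omega>))"
    by (simp only: bexp_cmult)
  also have "\<dots> \<le> E (\<lambda>\<omega>. \<Sum>vs\<in>cyc S. all_on (set (cycle_edges vs)) \<omega>)"
  proof (intro bexp_mono finite_A)
    fix \<omega>
    show "u * of_bool (cyc_event S \<omega>) \<le> (\<Sum>vs\<in>cyc S. all_on (set (cycle_edges vs)) \<omega>)"
    proof (cases "cyc_event S \<omega>")
      case True
      then obtain vs where vs: "vs \<in> cyc S" "\<forall>e\<in>set (cycle_edges vs). \<omega> e" by (auto simp: cyc_event_def)
      have "u \<le> real (length vs)" using vs(1) assms(3) by (auto simp: cyc_def)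
      also have "\<dots> = (\<Sum>i<length vs. all_on (set (cycle_edges (rotate i vs))) \<omega>)"
        using vs(2) by (simp add: cycle_edges_rotate all_on_def)
      also have "\<dots> = (\<Sum>us\<in>(\<lambda>i. rotate i vs) ` {..<length vs}. all_on (set (cycle_edges us)) \<omega>)"
        using rotations_in_cyc(2)[OF vs(1)] by (simp add: sum.reindex)
      also have "\<dots> \<le> (\<Sum>vs\<in>cyc S. all_on (set (cycle_edges vs)) \<omega>)"
        using rotations_in_cyc(1)[OF vs(1)] finite_cyc[OF assms(1)] 
        by (intro sum_mono2) (auto simp: all_on_def)
      finally show ?thesis using True by simp
    qed (auto simp: all_on_def intro!: sum_nonneg)
  qed
  also have "\<dots> = (\<Sum>vs\<in>cyc S. (1 / real n) ^ length vs)"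
    unfolding bexp_sum[OF finite_A] by (intro sum.cong refl E_cycle assms(4))
  also have "\<dots> \<le> card S" by (rule sum_cyc_prob_le[OF assms(1)])
  finally show ?thesis using assms(2) by (simp add: field_simps)
qed

lemma no_cycle_union:
  "E (\<lambda>\<omega>. of_bool (\<not> cyc_event S \<omega>)) * E (\<lambda>\<omega>. of_bool (\<not> cyc_event T \<omega>))
    \<le> E (\<lambda>\<omega>. of_bool (\<not> cyc_event (S \<union> T) \<omega>))"
proof -
  \<comment> \<open>Minus the indicator that there is no cycle: it is increasing, and the two signs
    cancel in the product.\<close>
  let ?g = "\<lambda>S \<omega>. of_bool (cyc_event S \<omega>) - (1::real)"
  have mono: "mono (?g S)" for S using mono_cyc_event[of S] by (auto simp: mono_def)
  have eq: "of_bool (\<not> cyc_event S \<omega>) = (-1) * ?g S \<omega>" for S \<omega> by auto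
  have un: "cyc_event (S \<union> T) \<omega> \<longleftrightarrow> cyc_event S \<omega> \<or> cyc_event T \<omega>" for \<omega>
    by (auto simp: cyc_event_def cyc_def)
  have "E (?g S) * E (?g T) \<le> E (\<lambda>\<omega>. ?g S \<omega> * ?g T \<omega>)"
    using p_range by (intro bexp_Harris finite_A mono) auto
  also have "(\<lambda>\<omega>. ?g S \<omega> * ?g T \<omega>) = (\<lambda>\<omega>. of_bool (\<not> cyc_event (S \<union> T) \<omega>))"
    unfolding un by auto
  finally show ?thesis unfolding eq[of S] eq[of T] bexp_cmult by simp
qed

text \<open>Windows of width \<open>a / 4 * N\<close> are added one at a time. Each holds at most
  \<open>a / 4 * N + 1 \<le> a * N / 2\<close> integers, all above \<open>a * N\<close>, so it is
  hit with probability at most 1/2; Harris multiplies the probabilities of avoidance.\<close>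

lemma no_cycle_ge:
  "(1 / 2) ^ k \<le> E (\<lambda>\<omega>. of_bool (\<not> cyc_event {m. a * N < real m \<and> real m \<le> (a + k * (a / 4)) * N} \<omega>))"
proof (induction k)
  case 0
  have "cyc {m. a * N < real m \<and> real m \<le> (a + 0 * (a / 4)) * N} = {}" by (auto simp: cyc_def)
  then show ?case by (simp add: cyc_event_def)
next
  case (Suc k)
  define u where "u = (a + k * (a / 4)) * N"
  let ?S = "{m. a * N < real m \<and> real m \<le> u}" and ?T = "{m. u < real m \<and> real m \<le> u + a / 4 * N}"
  have u: "a * N \<le> u" using a N_ge by (simp add: u_def)
  have un: "{m. a * N < real m \<and> real m \<le> (a + Suc k * (a / 4)) * N} = ?S \<union> ?T"
  proof -
    have "(a + Suc k * (a / 4)) * N = u + a / 4 * N" by (simp add: u_def algebra_simps add_divide_distrib)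
    moreover have "0 \<le> a / 4 * N" using a N_ge by simp
    ultimately show ?thesis using u by auto
  qed
  have T: "?T \<subseteq> {nat \<lfloor>u\<rfloor> + 1..nat \<lfloor>u + a / 4 * N\<rfloor>}"
    using u aN by (auto simp: le_nat_floor) linarith
  then have finT: "finite ?T" by (rule finite_subset) simp
  have "card ?T \<le> nat \<lfloor>u + a / 4 * N\<rfloor> - nat \<lfloor>u\<rfloor>"
    using card_mono[OF _ T] by simp
  moreover have "0 \<le> u" "0 \<le> a / 4 * N" using u aN by auto
  ultimately have "card ?T \<le> a / 4 * N + 1" by linarith
  then have "card ?T / u \<le> (a / 4 * N + 1) / (a * N)"
    using u aN by (intro frac_le) auto
  also have "\<dots> \<le> 1 / 2" using aN by (simp add: field_simps)
  finally have "card ?T / u \<le> 1 / 2" .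
  moreover have "E (\<lambda>\<omega>. of_bool (cyc_event ?T \<omega>)) \<le> card ?T / u"
    using u aN by (intro prob_cyc_event_le finT) auto
  moreover have "E (\<lambda>\<omega>. of_bool (\<not> cyc_event ?T \<omega>)) = 1 - E (\<lambda>\<omega>. of_bool (cyc_event ?T \<omega>))"
    by (simp add: of_bool_not_iff bexp_diff finite_A)
  ultimately have "1 / 2 \<le> E (\<lambda>\<omega>. of_bool (\<not> cyc_event ?T \<omega>))" by linarith
  then have "(1 / 2) ^ k * (1 / 2) \<le> E (\<lambda>\<omega>. of_bool (\<not> cyc_event ?S \<omega>)) * E (\<lambda>\<omega>. of_bool (\<not> cyc_event ?T \<omega>))"
    using Suc.IH unfolding u_def[symmetric] by (intro mult_mono bexp_nonneg finite_A) auto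
  also have "\<dots> \<le> E (\<lambda>\<omega>. of_bool (\<not> cyc_event (?S \<union> ?T) \<omega>))" by (rule no_cycle_union)
  finally show ?case unfolding un by simp
qed

lemma prob_cycle_le:
  assumes "b \<le> a + k * (a / 4)"
  shows "E (\<lambda>\<omega>. of_bool (cyc_event lens \<omega>)) \<le> 1 - (1 / 2) ^ k"
proof -
  let ?S = "{m. a * N < real m \<and> real m \<le> (a + k * (a / 4)) * N}"
  have "b * N \<le> (a + k * (a / 4)) * N" using assms N_ge by (intro mult_right_mono) auto
  then have "lens \<subseteq> ?S" by (auto simp: lens_def)
  then have "cyc_event lens \<omega> \<Longrightarrow> cyc_event ?S \<omega>" for \<omega> by (auto simp: cyc_event_def cyc_def)
  then have "E (\<lambda>\<omega>. of_bool (\<not> cyc_event ?S \<omega>)) \<le> E (\<lambda>\<omega>. 1 - of_bool (cyc_event lens \<omega>))"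
    by (intro bexp_mono finite_A) auto
  then show ?thesis using no_cycle_ge[of k] by (simp add: bexp_diff finite_A)
qed

end

section \<open>Noise sensitivity of medium cycles\<close>

definition noise_gap :: "'e set \<Rightarrow> real \<Rightarrow> (('e \<Rightarrow> bool) \<Rightarrow> bool) \<Rightarrow> real \<Rightarrow> real" where
  "noise_gap A p f \<epsilon> = \<P>((\<omega>, \<omega>') in measure_pmf (noise_pair A p \<epsilon>). f \<omega>' \<bar> f \<omega>) - prob_true A p f"

definition witness_gap :: "'e set \<Rightarrow> real \<Rightarrow> (('e \<Rightarrow> bool) \<Rightarrow> bool) \<Rightarrow> real \<Rightarrow> real" where
  "witness_gap A p f \<epsilon> = (MAX W\<in>one_witnesses A f.
     \<P>((\<omega>, \<omega>') in measure_pmf (noise_pair A p \<epsilon>). f \<omega>' \<bar> \<forall>e\<in>W. \<omega> e)) - prob_true A p f"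

lemma quant_noise_sensitive_gap:
  "quant_noise_sensitive \<Lambda> p f \<epsilon> \<longleftrightarrow> (\<lambda>n. noise_gap (\<Lambda> n) (p n) (f n) (\<epsilon> n)) \<longlonglongrightarrow> 0"
  by (simp only: quant_noise_sensitive_def noise_gap_def)

lemma quant_one_strongly_noise_sensitive_gap:
  "quant_one_strongly_noise_sensitive \<Lambda> p f \<epsilon> \<longleftrightarrow> (\<lambda>n. witness_gap (\<Lambda> n) (p n) (f n) (\<epsilon> n)) \<longlonglongrightarrow> 0"
  by (simp only: quant_one_strongly_noise_sensitive_def witness_gap_def)

context bernoulli_cube begin

lemma noise_gap_eq:
  assumes "0 < E (\<lambda>\<omega>. of_bool (f \<omega>))"
  shows "E (\<lambda>\<omega>. of_bool (f \<omega>)) * noise_gap A p f \<epsilon>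
    = noise_corr A p \<epsilon> (\<lambda>\<omega>. of_bool (f \<omega>)) (\<lambda>\<omega>. of_bool (f \<omega>)) - (E (\<lambda>\<omega>. of_bool (f \<omega>)))\<^sup>2"
  using assms unfolding noise_gap_def cond_prob_noise prob_true_bexp
  by (simp add: field_simps power2_eq_square)

text \<open>\<open>Max\<close> of an empty set is unspecified, so bounding the witness gap requires
  a witness.\<close>

lemma one_witnesses_nonempty:
  assumes "mono f" "0 < E (\<lambda>\<omega>. of_bool (f \<omega>))"
  shows "one_witnesses A f \<noteq> {}"
proof
  assume none: "one_witnesses A f = {}"
  have "\<not> f \<omega>" if "\<omega> \<in> configs A" for \<omega>
    using one_witness_exists[OF finite_A assms(1) that] none by auto
  then have "E (\<lambda>\<omega>. of_bool (f \<omega>)) = E (\<lambda>_. 0)" by (intro bexp_cong finite_A) auto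
  then show False using assms(2) by simp
qed

lemma witness_gap_eq:
  assumes "0 < p" "0 \<le> \<epsilon>" "\<epsilon> \<le> 1"
  shows "witness_gap A p f \<epsilon>
    = (MAX W\<in>one_witnesses A f. bexp A (witness_law \<epsilon> W) (\<lambda>\<omega>. of_bool (f \<omega>))) - E (\<lambda>\<omega>. of_bool (f \<omega>))"
proof -
  have "(\<lambda>W. \<P>((\<omega>, \<omega>') in measure_pmf (noise_pair A p \<epsilon>). f \<omega>' \<bar> \<forall>e\<in>W. \<omega> e)) ` one_witnesses A f
      = (\<lambda>W. bexp A (witness_law \<epsilon> W) (\<lambda>\<omega>. of_bool (f \<omega>))) ` one_witnesses A f"
    using assms by (intro image_cong refl cond_prob_witness) (auto dest: one_witnessesD(1))
  then show ?thesis by (simp only: witness_gap_def prob_true_bexp)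
qed

lemma noise_gap_nonneg:
  assumes "0 < E (\<lambda>\<omega>. of_bool (f \<omega>))"
  shows "0 \<le> noise_gap A p f \<epsilon>"
  using noise_gap_eq[OF assms, of \<epsilon>] noise_corr_ge_square[of "\<lambda>\<omega>. of_bool (f \<omega>)" \<epsilon>] assms
  by (smt (verit) mult_pos_neg)

text \<open>The witness bound on the autocorrelation, divided by the probability of
  \<open>f\<close>. It transfers strong noise sensitivity to noise sensitivity for the same
  \<open>\<epsilon>\<close>.\<close>

lemma noise_gap_le_witness_gap:
  assumes "mono f" "0 < p" "0 \<le> \<epsilon>" "\<epsilon> \<le> 1" "0 < E (\<lambda>\<omega>. of_bool (f \<omega>))"
  shows "noise_gap A p f \<epsilon> \<le> witness_gap A p f \<epsilon>"
proof -
  define P where "P = E (\<lambda>\<omega>. of_bool (f \<omega>))"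
  let ?g = "\<lambda>W. bexp A (witness_law \<epsilon> W) (\<lambda>\<omega>. of_bool (f \<omega>))"
  have "?g W \<le> (MAX W\<in>one_witnesses A f. ?g W)" if "W \<in> one_witnesses A f" for W
    using that by (intro Max_ge finite_imageI finite_one_witnesses finite_A) auto
  then have "noise_corr A p \<epsilon> (\<lambda>\<omega>. of_bool (f \<omega>)) (\<lambda>\<omega>. of_bool (f \<omega>)) \<le> (MAX W\<in>one_witnesses A f. ?g W) * P"
    unfolding P_def using assms by (intro noise_corr_le_witness) auto
  moreover have "(MAX W\<in>one_witnesses A f. ?g W) = witness_gap A p f \<epsilon> + P"
    using witness_gap_eq[OF assms(2-4), of f] by (simp add: P_def)
  ultimately have "P * noise_gap A p f \<epsilon> \<le> (witness_gap A p f \<epsilon> + P) * P - P * P"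
    using noise_gap_eq[OF assms(5), of \<epsilon>] by (simp only: P_def[symmetric] power2_eq_square)
  then have "P * noise_gap A p f \<epsilon> \<le> P * witness_gap A p f \<epsilon>" by (simp add: algebra_simps)
  then show ?thesis using assms(5) by (simp add: P_def)
qed

end

context critical_graph begin

lemma witness_gap_le:
  assumes \<epsilon>: "0 < \<epsilon>" "\<epsilon> < 1" and small: "8 * b * (1 / (N * \<epsilon>)) \<le> 1 / 2"
    and pos: "0 < E (\<lambda>\<omega>. of_bool (cyc_event lens \<omega>))"
  shows "witness_gap (potential_edges n) (1 / real n) (cyc_event lens) \<epsilon>
    \<le> (2 / a + 16 * b * exp b) * (1 / (N * \<epsilon>))"
proof -
  let ?F = "\<lambda>\<omega>. of_bool (cyc_event lens \<omega>) :: real"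
  have "(MAX W\<in>one_witnesses (potential_edges n) (cyc_event lens). bexp (potential_edges n) (witness_law \<epsilon> W) ?F)
      \<le> E ?F + (exp (- (\<epsilon> * N * a / 2)) + exp b * (16 * b / (N * \<epsilon>)))"
    using witness_upper[OF _ \<epsilon>] small one_witnesses_nonempty[OF mono_cyc_event pos] 
    by (intro Max.boundedI finite_imageI finite_one_witnesses finite_A) auto
  \<comment> \<open>\<open>exp (- s) \<le> 1 / s\<close> trades the exponential decay for a multiple
    of \<open>1 / (N * \<epsilon>)\<close>, so that a single error term remains.\<close>
  moreover have "exp (- (\<epsilon> * N * a / 2)) \<le> 2 / a * (1 / (N * \<epsilon>))"
  proof -
    have "0 < \<epsilon> * N * a / 2" using \<epsilon> a N_ge by simp
    moreover have "\<epsilon> * N * a / 2 \<le> exp (\<epsilon> * N * a / 2)" using exp_ge_add_one_self[of "\<epsilon> * N * a / 2"] by linarith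
    ultimately have "exp (- (\<epsilon> * N * a / 2)) \<le> 1 / (\<epsilon> * N * a / 2)"
      using frac_le[of 1 1 "\<epsilon> * N * a / 2" "exp (\<epsilon> * N * a / 2)"] by (simp add: exp_minus inverse_eq_divide)
    then show ?thesis by (simp add: mult_ac)
  qed
  ultimately show ?thesis
    using \<epsilon> n_ge by (simp add: witness_gap_eq algebra_simps)
qed

text \<open>\<open>X\<close> is the test function. Each cycle it counts raises the probability of
  the event after noise by at least \<open>\<theta>\<close>, so the covariance is at least
  \<open>E X * \<theta>\<close>; the second moment of \<open>X\<close> supplies the denominator.
  Passing from correlation to conditional probability divides by a number at most 1.\<close>

lemma noise_gap_ge:
  assumes gap: "4 \<le> (b - a) * N" and \<epsilon>: "0 < \<epsilon>" "\<epsilon> \<le> 1 / 2" "\<epsilon> * N \<le> K"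
    and P: "0 < E (\<lambda>\<omega>. of_bool (cyc_event lens \<omega>))" "E (\<lambda>\<omega>. of_bool (cyc_event lens \<omega>)) \<le> 1 - \<delta>"
    and \<theta>: "0 \<le> \<theta>" "\<theta> \<le> exp (- 2 * K * b) * \<delta> - b / N\<^sup>2"
  shows "((b - a) / 4 * \<theta>)\<^sup>2 / (b\<^sup>2 * (3 + exp (4 * (1 + b) * b)))
    \<le> noise_gap (potential_edges n) (1 / real n) (cyc_event lens) \<epsilon>"
proof -
  let ?F = "\<lambda>\<omega>. of_bool (cyc_event lens \<omega>) :: real"
  let ?corr = "noise_corr (potential_edges n) (1 / real n) \<epsilon>"
  define M where "M = b\<^sup>2 * (3 + exp (4 * (1 + b) * b))"
  have M: "0 < M" using a ab by (auto simp: M_def add_pos_pos)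
  have lower: "E ?F + \<theta> \<le> bexp (potential_edges n) (witness_law \<epsilon> (set (cycle_edges cs))) ?F"
    if "cs \<in> cyc lens" for cs
  proof -
    have "exp (- 2 * K * b) * \<delta> \<le> exp (- 2 * K * b) * (1 - E ?F)" using P by (intro mult_left_mono) auto
    then show ?thesis using witness_lower[OF that \<epsilon>] \<theta> by linarith
  qed
  have "(b - a) / 4 * \<theta> \<le> E X * \<theta>" using E_X_ge[OF gap] \<theta> by (intro mult_right_mono)
  also have "\<dots> \<le> ?corr X ?F - E ?F * E X"
  proof -
    have "E X * (E ?F + \<theta>) = (\<Sum>cs\<in>cyc lens. (1 / N) * ((1 / real n) ^ length cs * (E ?F + \<theta>)))"
      by (simp add: E_X sum_distrib_left sum_distrib_right mult.assoc)
    also have "\<dots> \<le> (\<Sum>cs\<in>cyc lens. (1 / N) * ((1 / real n) ^ length cs *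
        bexp (potential_edges n) (witness_law \<epsilon> (set (cycle_edges cs))) ?F))"
      using N_ge lower by (intro sum_mono mult_left_mono) auto
    also have "\<dots> = (\<Sum>cs\<in>cyc lens. (1 / N) * ?corr (all_on (set (cycle_edges cs))) ?F)"
    proof (intro sum.cong refl arg_cong2[of _ _ _ _ "(*)"])
      fix cs assume cs: "cs \<in> cyc lens"
      have "?corr (all_on (set (cycle_edges cs))) ?F = (1 / real n) ^ card (set (cycle_edges cs))
          * bexp (potential_edges n) (witness_law \<epsilon> (set (cycle_edges cs))) ?F"
        using \<epsilon> cycle_edges_potential[OF cs] lens_bounds(1) by (intro noise_corr_all_on) auto
      then show "(1 / real n) ^ length cs * bexp (potential_edges n) (witness_law \<epsilon> (set (cycle_edges cs))) ?F
          = ?corr (all_on (set (cycle_edges cs))) ?F"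
        using card_cycle_edges[OF cs] lens_bounds(1) by simp
    qed
    also have "\<dots> = (\<Sum>cs\<in>cyc lens. ?corr (\<lambda>\<omega>. (1 / N) * all_on (set (cycle_edges cs)) \<omega>) ?F)"
      by (simp only: mult.assoc noise_exp_cmult)
    also have "\<dots> = ?corr X ?F"
      unfolding X_def by (rule noise_corr_sum_left[symmetric])
    finally show ?thesis by (simp add: algebra_simps)
  qed
  finally have "((b - a) / 4 * \<theta>)\<^sup>2 / M \<le> ?corr ?F ?F - (E ?F)\<^sup>2"
    using ab \<theta> M second_moment by (intro noise_corr_test_function[where v = X]) (auto simp: M_def)
  also have "\<dots> = E ?F * noise_gap (potential_edges n) (1 / real n) (cyc_event lens) \<epsilon>"
    using noise_gap_eq[OF P(1)] by simp
  also have "\<dots> \<le> 1 * noise_gap (potential_edges n) (1 / real n) (cyc_event lens) \<epsilon>"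
  proof (rule mult_right_mono)
    show "E ?F \<le> 1" using bexp_mono[OF finite_A, of ?F "\<lambda>_. 1"] by simp
  qed (rule noise_gap_nonneg[OF P(1)])
  finally show ?thesis by (simp add: M_def)
qed

end

lemma filterlim_cube_root: "filterlim (\<lambda>n. real n powr (1 / 3)) at_top sequentially"
  by real_asymp

lemma eventually_critical_graph:
  assumes "0 < a" "a < b"
  shows "\<forall>\<^sub>F n in sequentially. critical_graph n a b (real n powr (1 / 3)) \<and> 4 \<le> (b - a) * real n powr (1 / 3)"
proof -
  have "\<forall>\<^sub>F n in sequentially. c \<le> real n powr (1 / 3)" for c
    using filterlim_cube_root by (auto simp: filterlim_at_top)
  note ev = this[of "4 / a"] this[of "2 * b\<^sup>2"] this[of "4 * (1 + b)"] this[of "4 / (b - a)"]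
  show ?thesis
    using ev
  proof eventually_elim
    case (elim n)
    then show ?case using assms by (auto simp: critical_graph_def field_simps)
  qed
qed

theorem theorem1p3:
  fixes a b :: real and p :: "nat \<Rightarrow> real" and f :: "nat \<Rightarrow> (nat set \<Rightarrow> bool) \<Rightarrow> bool"
  assumes "0 < a" and "a < b"
  defines "p \<equiv> \<lambda>n. 1 / real n"
    and "f \<equiv> has_medium_cycle a b"
  shows "nondegenerate potential_edges p f \<and>
         noise_sensitive potential_edges p f \<and>
         one_strongly_noise_sensitive potential_edges p f \<and>
         (\<forall>\<epsilon> :: nat \<Rightarrow> real. (\<forall>n. \<epsilon> n \<in> {0<..<1}) \<longrightarrow>
            (quant_noise_sensitive potential_edges p f \<epsilon> \<longleftrightarrow>
               much_greater \<epsilon> (\<lambda>n. real n powr (- 1/3))) \<and>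
            (quant_one_strongly_noise_sensitive potential_edges p f \<epsilon> \<longleftrightarrow>
               much_greater \<epsilon> (\<lambda>n. real n powr (- 1/3))))"
proof -
  define N where "N = (\<lambda>n. real n powr (1 / 3))"
  define P where "P = (\<lambda>n. prob_true (potential_edges n) (p n) (f n))"
  define M where "M = b\<^sup>2 * (3 + exp (4 * (1 + b) * b))"
  define \<delta>0 where "\<delta>0 = ((b - a) / 4)\<^sup>2 / M"
  \<comment> \<open>\<open>k\<close> windows of width \<open>a / 4\<close> reach from
    \<open>a\<close> to \<open>b\<close>.\<close>
  obtain k :: nat where "(b - a) / (a / 4) \<le> real k" using real_arch_simple by blast
  then have k: "b \<le> a + k * (a / 4)" using assms(1) by (simp add: field_simps)
  define \<delta>1 :: real where "\<delta>1 = (1 / 2) ^ k"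
  have M: "0 < M" using assms by (auto simp: M_def add_pos_pos)
  have \<delta>: "0 < \<delta>0" "0 < \<delta>1" using assms M by (auto simp: \<delta>0_def \<delta>1_def)
  have crit: "\<forall>\<^sub>F n in sequentially. critical_graph n a b (N n) \<and> 4 \<le> (b - a) * N n"
    unfolding N_def by (rule eventually_critical_graph[OF assms(1,2)])
  have N_top: "filterlim N at_top sequentially" unfolding N_def by (rule filterlim_cube_root)
  have P_bounds: "\<forall>\<^sub>F n in sequentially. \<delta>0 \<le> P n \<and> P n \<le> 1 - \<delta>1"
    using crit
  proof eventually_elim
    case (elim n)
    then interpret critical_graph n a b "N n" by simp
    show ?case
      using prob_cycle_ge prob_cycle_le[OF k] elim
      by (simp add: P_def p_def f_def prob_true_bexp medium_cycle_eq \<delta>0_def \<delta>1_def M_def)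
  qed
  have "nondegenerate potential_edges p f"
    unfolding nondegenerate_def using \<delta> P_bounds
    by (intro exI[of _ "min \<delta>0 \<delta>1"]) (auto simp: P_def elim: eventually_mono)
  moreover have main: "(quant_noise_sensitive potential_edges p f \<epsilon> \<longleftrightarrow> much_greater \<epsilon> (\<lambda>n. real n powr (- 1/3))) \<and>
      (quant_one_strongly_noise_sensitive potential_edges p f \<epsilon> \<longleftrightarrow> much_greater \<epsilon> (\<lambda>n. real n powr (- 1/3)))"
    if \<epsilon>: "\<forall>n. \<epsilon> n \<in> {0<..<1}" for \<epsilon>
  proof -
    \<comment> \<open>The ratio of \<open>n powr (- 1/3)\<close> to \<open>\<epsilon> n\<close>; the
      criterion says that it tends to 0.\<close>
    define u where "u = (\<lambda>n. 1 / (N n * \<epsilon> n))"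
    define nG wG where "nG = (\<lambda>n. noise_gap (potential_edges n) (p n) (f n) (\<epsilon> n))"
      and "wG = (\<lambda>n. witness_gap (potential_edges n) (p n) (f n) (\<epsilon> n))"
    have \<epsilon>': "0 < \<epsilon> n" "\<epsilon> n < 1" for n using \<epsilon> by auto
    have u_nonneg: "0 \<le> u n" for n using \<epsilon>'[of n] by (simp add: u_def N_def)
    have mg: "much_greater \<epsilon> (\<lambda>n. real n powr (- 1/3)) \<longleftrightarrow> u \<longlonglongrightarrow> 0"
      unfolding much_greater_def u_def N_def by (simp add: powr_minus field_simps)
    have sandwich: "\<forall>\<^sub>F n in sequentially. 0 \<le> nG n \<and> nG n \<le> wG n"
      using crit P_bounds
    proof eventually_elim
      case (elim n)
      then interpret critical_graph n a b "N n" by simp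
      have "0 < E (\<lambda>\<omega>. of_bool (cyc_event lens \<omega>))"
        using elim \<delta> by (simp add: P_def p_def f_def prob_true_bexp medium_cycle_eq)
      then show ?case
        using noise_gap_nonneg noise_gap_le_witness_gap[OF mono_cyc_event] \<epsilon>'[of n] n_ge
        by (simp add: nG_def wG_def p_def f_def medium_cycle_eq)
    qed
    have upper: "\<forall>\<^sub>F n in sequentially. 8 * b * u n \<le> 1 / 2 \<longrightarrow> wG n \<le> (2 / a + 16 * b * exp b) * u n"
      using crit P_bounds
    proof eventually_elim
      case (elim n)
      then interpret critical_graph n a b "N n" by simp
      have "0 < E (\<lambda>\<omega>. of_bool (cyc_event lens \<omega>))"
        using elim \<delta> by (simp add: P_def p_def f_def prob_true_bexp medium_cycle_eq)
      then show ?case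
        using witness_gap_le[OF \<epsilon>'] unfolding wG_def u_def p_def f_def medium_cycle_eq by blast
    qed
    have lower: "\<exists>c>0. \<forall>\<^sub>F n in sequentially. \<epsilon> n * N n \<le> K \<longrightarrow> c \<le> nG n" for K
    proof -
      \<comment> \<open>Half of the gain from a surviving cycle; for large \<open>N\<close> the
        other half absorbs the error \<open>b / N\<^sup>2\<close>.\<close>
      define \<theta> where "\<theta> = exp (- 2 * K * b) * \<delta>1 / 2"
      have \<theta>: "0 < \<theta>" using \<delta> by (simp add: \<theta>_def)
      have ev1: "\<forall>\<^sub>F n in sequentially. max 1 (max (2 * K) (b / \<theta>)) \<le> N n"
        using N_top unfolding filterlim_at_top by blast
      have "\<forall>\<^sub>F n in sequentially. \<epsilon> n * N n \<le> K \<longrightarrow> ((b - a) / 4 * \<theta>)\<^sup>2 / M \<le> nG n"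
        using crit P_bounds ev1
      proof eventually_elim
        case (elim n)
        then interpret critical_graph n a b "N n" by simp
        have pos: "0 < E (\<lambda>\<omega>. of_bool (cyc_event lens \<omega>))"
          and le: "E (\<lambda>\<omega>. of_bool (cyc_event lens \<omega>)) \<le> 1 - \<delta>1"
          using elim \<delta> by (simp_all add: P_def p_def f_def prob_true_bexp medium_cycle_eq)
        show ?case
        proof
          assume K: "\<epsilon> n * N n \<le> K"
          moreover have "2 * K \<le> N n" using elim by simp
          ultimately have "\<epsilon> n * N n \<le> 1 / 2 * N n" by linarith
          then have half: "\<epsilon> n \<le> 1 / 2" using N_ge(3) by (rule mult_right_le_imp_le)
          have "b / \<theta> \<le> N n * 1" using elim by simp
          also have "\<dots> \<le> N n * N n" using N_ge by (intro mult_left_mono) auto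
          finally have "b / (N n)\<^sup>2 \<le> \<theta>"
            using \<theta> N_ge by (simp add: field_simps power2_eq_square)
          moreover have "exp (- 2 * K * b) * \<delta>1 = 2 * \<theta>" by (simp only: \<theta>_def)
          ultimately have "\<theta> \<le> exp (- 2 * K * b) * \<delta>1 - b / (N n)\<^sup>2" by linarith
          then show "((b - a) / 4 * \<theta>)\<^sup>2 / M \<le> nG n"
            unfolding M_def nG_def p_def f_def medium_cycle_eq
            using elim \<theta> K half \<epsilon>'[of n] pos le by (intro noise_gap_ge) auto
        qed
      qed
      moreover have "0 < ((b - a) / 4 * \<theta>)\<^sup>2 / M" using \<theta> M assms by simp
      ultimately show ?thesis by blast
    qed
    have zero: "u \<longlonglongrightarrow> 0 \<Longrightarrow> wG \<longlonglongrightarrow> 0"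
    proof -
      assume u0: "u \<longlonglongrightarrow> 0"
      have "\<forall>\<^sub>F n in sequentially. u n < 1 / (16 * b)"
        using assms by (intro order_tendstoD[OF u0]) auto
      then have "\<forall>\<^sub>F n in sequentially. wG n \<le> (2 / a + 16 * b * exp b) * u n"
        using upper
      proof eventually_elim
        case (elim n)
        then have "8 * b * u n \<le> 1 / 2" using assms by (simp add: field_simps)
        then show ?case using elim by simp
      qed
      moreover have "\<forall>\<^sub>F n in sequentially. 0 \<le> wG n" using sandwich by eventually_elim simp
      moreover have "(\<lambda>n. (2 / a + 16 * b * exp b) * u n) \<longlonglongrightarrow> 0" using tendsto_mult_right_zero[OF u0] .
      ultimately show ?thesis by (intro tendsto_sandwich[of "\<lambda>_. 0" wG _ _ 0]) auto
    qed
    have nG_wG: "wG \<longlonglongrightarrow> 0 \<Longrightarrow> nG \<longlonglongrightarrow> 0"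
      using sandwich by (intro tendsto_sandwich[of "\<lambda>_. 0" nG _ wG 0]) (auto elim: eventually_mono)
    have "nG \<longlonglongrightarrow> 0 \<Longrightarrow> u \<longlonglongrightarrow> 0"
    proof -
      assume nG0: "nG \<longlonglongrightarrow> 0"
      show "u \<longlonglongrightarrow> 0"
      proof (rule order_tendstoI)
        fix r :: real assume r: "0 < r"
        \<comment> \<open>\<open>u n \<ge> r\<close> means
          \<open>\<epsilon> n * N n \<le> 1 / r\<close>, which would keep the gap above
          \<open>c\<close>; since the gap tends to 0, this happens only finitely often.\<close>
        obtain c where c: "0 < c" "\<forall>\<^sub>F n in sequentially. \<epsilon> n * N n \<le> 1 / r \<longrightarrow> c \<le> nG n"
          using lower by blast
        have "\<forall>\<^sub>F n in sequentially. nG n < c" using order_tendstoD(2)[OF nG0 c(1)] .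
        then show "\<forall>\<^sub>F n in sequentially. u n < r"
          using c(2)
        proof eventually_elim
          case (elim n)
          then have "1 / r < \<epsilon> n * N n" by force
          moreover have "0 < 1 / r" using r by simp
          ultimately have "0 < \<epsilon> n * N n" by (rule less_trans[rotated])
          with \<open>1 / r < \<epsilon> n * N n\<close> have "1 / (\<epsilon> n * N n) < r" using r by (simp add: field_simps)
          then show ?case by (simp add: u_def mult.commute)
        qed
      qed (use u_nonneg in \<open>auto intro: always_eventually less_le_trans\<close>)
    qed
    then show ?thesis
      using zero nG_wG mg
      unfolding quant_noise_sensitive_gap quant_one_strongly_noise_sensitive_gap nG_def[symmetric] wG_def[symmetric]
      by blast
  qed
  \<comment> \<open>A constant \<open>\<epsilon>\<close> satisfies the criterion, so both
    fixed-noise statements are instances of \<open>main\<close>.\<close>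
  moreover have "much_greater (\<lambda>_. \<epsilon>) (\<lambda>n. real n powr (- 1/3))" if "\<epsilon> \<in> {0<..<1}" for \<epsilon>
  proof -
    have "(\<lambda>n. real n powr (- 1/3)) \<longlonglongrightarrow> 0"
      by (rule tendsto_neg_powr[OF _ filterlim_real_sequentially]) simp
    then show ?thesis using that by (auto simp: much_greater_def intro!: tendsto_divide_zero)
  qed
  then have "noise_sensitive potential_edges p f" "one_strongly_noise_sensitive potential_edges p f"
    unfolding noise_sensitive_def one_strongly_noise_sensitive_def using main by auto
  ultimately show ?thesis by blast
qed

end
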